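(* Let $a,b,d,\alpha>0$ with $\frac{a^2}{4}\ge b$, $n=1$, and $\phi(x)=\frac{\alpha}{2}e^{-\alpha|x|}$, $x\in\mathbb{R}$. (i) If $\frac{a^2}{4}>b$: the problem $\mathcal{L}_1\psi=\lambda\psi$ is spectrally stable if $d\ge\frac{(c_1-\sqrt{c_1^2-b})^2}{\alpha^2}$ and spectrally unstable if $0<d<\frac{(c_1-\sqrt{c_1^2-b})^2}{\alpha^2}$; the problem $\mathcal{L}_2\psi=\lambda\psi$ is spectrally unstable. (ii) If $\frac{a^2}{4}=b$: for $k=1,2$ the problem $\mathcal{L}_k\psi=\lambda\psi$ is spectrally stable if $d\ge\frac{b}{\alpha^2}$ and spectrally unstable if $0<d<\frac{b}{\alpha^2}$.
   Context: $c_1=\frac{a}{2}+\sqrt{\frac{a^2}{4}-b}$, $c_2=\frac{a}{2}-\sqrt{\frac{a^2}{4}-b}$ are the constant solutions of $\partial_t u=d\Delta u+u^2\bigl(a-\int_{\mathbb{R}^n}\phi(x-y)u(y,t)dy\bigr)-bu$. Linearizing about $c_k$ via $u=c_k+\psi(x)e^{-\lambda t}$ gives $\mathcal{L}_k\psi=-d\Delta\psi+c_k^2\int_{\mathbb{R}^n}\phi(x-y)\psi(y)dy-b\psi$, $k=1,2$, self-adjoint on $L^2(\mathbb{R}^n)$ with domain $H^2(\mathbb{R}^n)$. The problem $\mathcal{L}_k\psi=\lambda\psi$ is spectrally stable if $\sigma(\mathcal{L}_k)\subseteq[0,\infty)$ and spectrally unstable if $\sigma(\mathcal{L}_k)$ contains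 some $\lambda<0$. *)

theory Defs
  imports "HOL-Analysis.Analysis"
begin

text \<open>Functions on the real line are complex valued; L2 elements are represented by
  square-integrable functions (identified up to a.e. equality where relevant).\<close>

definition sq_int :: "(real \<Rightarrow> complex) \<Rightarrow> bool" where
  "sq_int f \<longleftrightarrow> f \<in> borel_measurable lborel \<and> integrable lborel (\<lambda>x. (cmod (f x))^2)"

definition L2norm :: "(real \<Rightarrow> complex) \<Rightarrow> real" where
  "L2norm f = sqrt (LINT x|lborel. (cmod (f x))^2)"

text \<open>H2(R): f continuously differentiable with derivative f1, f1 absolutely continuous with
  a.e. derivative f2, and f, f1, f2 square integrable. f2 is the (weak) second derivative.\<close>
definition H2_rep :: "(real \<Rightarrow> complex) \<Rightarrow> (real \<Rightarrow> complex) \<Rightarrow> bool" where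
  "H2_rep f f2 \<longleftrightarrow> sq_int f \<and> sq_int f2 \<and>
     (\<exists>f1. sq_int f1 \<and> (\<forall>x. (f has_vector_derivative f1 x) (at x)) \<and>
           (\<forall>x. f1 x = f1 0 + (LBINT t=ereal 0..ereal x. f2 t)))"

definition kernel :: "real \<Rightarrow> real \<Rightarrow> real" where
  "kernel \<alpha> x = \<alpha> / 2 * exp (- \<alpha> * \<bar>x\<bar>)"

definition conv :: "(real \<Rightarrow> real) \<Rightarrow> (real \<Rightarrow> complex) \<Rightarrow> real \<Rightarrow> complex" where
  "conv \<phi> f x = (LINT y|lborel. complex_of_real (\<phi> (x - y)) * f y)"

text \<open>L psi = - d psi'' + c^2 (phi * psi) - b psi, applied to psi in H2 with second derivative psi2.\<close>
definition Lop :: "real \<Rightarrow> real \<Rightarrow> real \<Rightarrow> (real \<Rightarrow> real) \<Rightarrow>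
    (real \<Rightarrow> complex) \<Rightarrow> (real \<Rightarrow> complex) \<Rightarrow> real \<Rightarrow> complex" where
  "Lop d c b \<phi> f f2 x = - complex_of_real d * f2 x + complex_of_real (c^2) * conv \<phi> f x
                         - complex_of_real b * f x"

definition resolvent_set :: "real \<Rightarrow> real \<Rightarrow> real \<Rightarrow> (real \<Rightarrow> real) \<Rightarrow> complex set" where
  "resolvent_set d c b \<phi> = {\<mu>.
     (\<forall>g. sq_int g \<longrightarrow> (\<exists>f f2. H2_rep f f2 \<and>
          (AE x in lborel. Lop d c b \<phi> f f2 x - \<mu> * f x = g x))) \<and>
     (\<exists>C. \<forall>f f2. H2_rep f f2 \<longrightarrow>
          L2norm f \<le> C * L2norm (\<lambda>x. Lop d c b \<phi> f f2 x - \<mu> * f x))}"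

definition spectrum_L :: "real \<Rightarrow> real \<Rightarrow> real \<Rightarrow> (real \<Rightarrow> real) \<Rightarrow> complex set" where
  "spectrum_L d c b \<phi> = - resolvent_set d c b \<phi>"

definition spectrally_stable :: "real \<Rightarrow> real \<Rightarrow> real \<Rightarrow> (real \<Rightarrow> real) \<Rightarrow> bool" where
  "spectrally_stable d c b \<phi> \<longleftrightarrow> spectrum_L d c b \<phi> \<subseteq> complex_of_real ` {0..}"

definition spectrally_unstable :: "real \<Rightarrow> real \<Rightarrow> real \<Rightarrow> (real \<Rightarrow> real) \<Rightarrow> bool" where
  "spectrally_unstable d c b \<phi> \<longleftrightarrow> (\<exists>l::real. l < 0 \<and> complex_of_real l \<in> spectrum_L d c b \<phi>)"

definition c1 :: "real \<Rightarrow> real \<Rightarrow> real" where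
  "c1 a b = a / 2 + sqrt (a^2 / 4 - b)"

definition c2 :: "real \<Rightarrow> real \<Rightarrow> real" where
  "c2 a b = a / 2 - sqrt (a^2 / 4 - b)"

end

theory Submission
  imports Defs "HOL-Probability.Sinc_Integral"
begin

text \<open>
  The operator has Fourier symbol \<open>q (\<xi>\<^sup>2) / (\<alpha>\<^sup>2 + \<xi>\<^sup>2)\<close> with
  \<open>q s = d s\<^sup>2 + (d \<alpha>\<^sup>2 - b) s + (c\<^sup>2 - b) \<alpha>\<^sup>2\<close>, and its spectrum is the closed range of this symbol.
  The Fourier transform is avoided: since \<open>h = \<phi> * \<psi>\<close> satisfies \<open>h'' = \<alpha>\<^sup>2 (h - \<psi>)\<close>, the resolvent
  equation is a system of two second-order equations, which decouples into scalar equations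
  \<open>k\<^sup>2 u - u'' = g\<close>. When \<open>\<mu>\<close> is not a value of the symbol, each can be solved with \<open>Re k > 0\<close> by
  convolution with \<open>exp (- k \<bar>x\<bar>) / (2 k)\<close>, which is bounded on \<open>L\<^sup>2\<close>. Conversely every value of the symbol
  lies in the spectrum because of the approximate eigenfunctions \<open>exp (\<i> \<xi> x) / (x + \<i> N)\<close>.
  The thresholds come from
  \<open>q s = (sqrt d s - e \<alpha>)\<^sup>2 + ((\<alpha> sqrt d + e)\<^sup>2 - c\<^sup>2) s\<close> with \<open>e\<^sup>2 = c\<^sup>2 - b\<close>.
\<close>

subsection \<open>Square-integrable functions and Sobolev spaces\<close>

lemma sq_int_measurable [measurable_dest]: "sq_int f \<Longrightarrow> f \<in> borel_measurable borel"
  by (simp add: sq_int_def)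

lemma sq_int_dominated:
  assumes "integrable lborel F" "f \<in> borel_measurable borel" "\<And>x. (cmod (f x))\<^sup>2 \<le> F x"
  shows "sq_int f"
proof -
  have [measurable]: "f \<in> borel_measurable borel" by fact
  have "integrable lborel (\<lambda>x. (cmod (f x))\<^sup>2)"
    by (rule Bochner_Integration.integrable_bound[OF assms(1)])
       (use assms(3) in \<open>auto intro!: AE_I2 intro: order_trans[OF _ abs_ge_self]\<close>)
  then show ?thesis by (simp add: sq_int_def)
qed

lemma cmod_add_square_le: "(cmod (x + y))\<^sup>2 \<le> 2 * (cmod x)\<^sup>2 + 2 * (cmod y)\<^sup>2"
proof -
  have "(cmod (x + y))\<^sup>2 \<le> (cmod x + cmod y)\<^sup>2"
    by (intro power_mono norm_triangle_ineq) auto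
  also have "\<dots> \<le> 2 * (cmod x)\<^sup>2 + 2 * (cmod y)\<^sup>2"
    using sum_squares_bound[of "cmod x" "cmod y"] by (simp add: power2_sum)
  finally show ?thesis .
qed

lemma sq_int_integrable: "sq_int f \<Longrightarrow> integrable lborel (\<lambda>x. (cmod (f x))\<^sup>2)"
  by (simp add: sq_int_def)

lemma sq_int_add: "sq_int f \<Longrightarrow> sq_int g \<Longrightarrow> sq_int (\<lambda>x. f x + g x)"
  by (rule sq_int_dominated[where F = "\<lambda>x. 2 * (cmod (f x))\<^sup>2 + 2 * (cmod (g x))\<^sup>2"])
     (auto simp: cmod_add_square_le intro!: Bochner_Integration.integrable_add integrable_mult_right
       dest: sq_int_integrable sq_int_measurable)

lemma sq_int_scale: "sq_int f \<Longrightarrow> sq_int (\<lambda>x. c * f x)"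
  by (rule sq_int_dominated[where F = "\<lambda>x. (cmod c)\<^sup>2 * (cmod (f x))\<^sup>2"])
     (auto simp: norm_mult power_mult_distrib dest: sq_int_integrable sq_int_measurable)

lemma sq_int_uminus: "sq_int f \<Longrightarrow> sq_int (\<lambda>x. - f x)"
  using sq_int_scale[of f "-1"] by simp

lemma sq_int_diff: "sq_int f \<Longrightarrow> sq_int g \<Longrightarrow> sq_int (\<lambda>x. f x - g x)"
  using sq_int_add[of f "\<lambda>x. - g x"] sq_int_uminus[of g] by simp

lemma sq_int_reflect:
  assumes "sq_int f" shows "sq_int (\<lambda>x. f (- x))"
proof -
  have [measurable]: "f \<in> borel_measurable borel" using assms by (rule sq_int_measurable)
  have "integrable lborel (\<lambda>x. (cmod (f (0 + (-1) * x)))\<^sup>2)"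
    using assms by (intro lborel_integrable_real_affine) (auto simp: sq_int_def)
  then show ?thesis by (simp add: sq_int_def)
qed

section \<open>The norm on square-integrable functions\<close>

lemma L2norm_nonneg: "0 \<le> L2norm f"
  by (simp add: L2norm_def)

lemma L2norm_scale: "L2norm (\<lambda>x. c * f x) = cmod c * L2norm f"
  by (simp add: L2norm_def norm_mult power_mult_distrib real_sqrt_mult)

lemma L2norm_reflect: "L2norm (\<lambda>x. f (- x)) = L2norm f"
  using lborel_integral_real_affine[of "-1" "\<lambda>x. (cmod (f x))\<^sup>2" 0] by (simp add: L2norm_def)

lemma L2norm_mono:
  assumes "sq_int f" "sq_int g" "\<And>x. cmod (f x) \<le> cmod (g x)"
  shows "L2norm f \<le> L2norm g"
  unfolding L2norm_def
  by (intro real_sqrt_le_mono integral_mono sq_int_integrable assms power_mono norm_ge_zero)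

text \<open>The factor 2 comes from the pointwise bound |x + y|^2 \<le> 2|x|^2 + 2|y|^2, which
  replaces Minkowski's inequality. Only finiteness of the resulting constants matters later.\<close>

lemma L2norm_add_le:
  assumes "sq_int f" "sq_int g"
  shows "L2norm (\<lambda>x. f x + g x) \<le> 2 * (L2norm f + L2norm g)"
proof -
  let ?F = "LINT x|lborel. (cmod (f x))\<^sup>2" and ?G = "LINT x|lborel. (cmod (g x))\<^sup>2"
  have nn: "?F \<ge> 0" "?G \<ge> 0" by auto
  have "(LINT x|lborel. (cmod (f x + g x))\<^sup>2)
      \<le> (LINT x|lborel. 2 * (cmod (f x))\<^sup>2 + 2 * (cmod (g x))\<^sup>2)"
    using assms by (intro integral_mono sq_int_integrable sq_int_add cmod_add_square_le)
      (auto intro!: Bochner_Integration.integrable_add integrable_mult_right sq_int_integrable)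
  also have "\<dots> = 2 * ?F + 2 * ?G"
    using assms by (simp add: sq_int_integrable)
  also have "\<dots> \<le> (2 * (sqrt ?F + sqrt ?G))\<^sup>2"
    using nn by (simp add: power_mult_distrib power2_sum)
  finally show ?thesis
    unfolding L2norm_def using nn by (intro real_le_lsqrt) auto
qed

text \<open>On a bounded interval the constant 1 is integrable, and |f| \<le> 1 + |f|^2.\<close>

lemma sq_int_set_integrable:
  assumes "sq_int f" shows "set_integrable lborel {a..b} f"
proof -
  have [measurable]: "f \<in> borel_measurable borel" using assms by (rule sq_int_measurable)
  have "integrable lborel (\<lambda>x. indicator {a..b} x + (cmod (f x))\<^sup>2)"
    using assms by (intro Bochner_Integration.integrable_add sq_int_integrable integrable_real_indicator)
      (auto simp: emeasure_lborel_Icc_eq)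
  then show ?thesis unfolding set_integrable_def
  proof (rule Bochner_Integration.integrable_bound)
    have "cmod (f x) \<le> 1 + (cmod (f x))\<^sup>2" for x
      using sum_squares_bound[of "cmod (f x)" 1] norm_ge_zero[of "f x"]
      by (simp del: norm_ge_zero)
    then show "AE x in lborel. norm (indicat_real {a..b} x *\<^sub>R f x) \<le> norm (indicator {a..b} x + (cmod (f x))\<^sup>2)"
      by (auto simp: indicator_def)
  qed auto
qed

text \<open>Local absolute continuity with a.e. derivative \<open>f1\<close>, encoded as the
  integral identity on every interval. No pointwise derivative and no oriented integral enters, so
  sums, multiples and reflections are easy and the predicate can be iterated for second
  derivatives.\<close>

definition H1_rep :: "(real \<Rightarrow> complex) \<Rightarrow> (real \<Rightarrow> complex) \<Rightarrow> bool" where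
  "H1_rep f f1 \<longleftrightarrow> sq_int f \<and> sq_int f1 \<and>
     (\<forall>a b. a \<le> b \<longrightarrow> (LINT t:{a..b}|lborel. f1 t) = f b - f a)"

lemma H1_rep_sq_int: "H1_rep f f1 \<Longrightarrow> sq_int f" "H1_rep f f1 \<Longrightarrow> sq_int f1"
  by (auto simp: H1_rep_def)

lemma H1_rep_add: "H1_rep f f1 \<Longrightarrow> H1_rep g g1 \<Longrightarrow> H1_rep (\<lambda>x. f x + g x) (\<lambda>x. f1 x + g1 x)"
  by (auto simp: H1_rep_def sq_int_add set_integral_add sq_int_set_integrable)

lemma H1_rep_scale: "H1_rep f f1 \<Longrightarrow> H1_rep (\<lambda>x. c * f x) (\<lambda>x. c * f1 x)"
  by (auto simp: H1_rep_def sq_int_scale right_diff_distrib)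

lemma H1_rep_reflect:
  assumes "H1_rep f f1" shows "H1_rep (\<lambda>x. f (- x)) (\<lambda>x. - f1 (- x))"
proof -
  have "(LINT t:{a..b}|lborel. - f1 (- t)) = f (- b) - f (- a)" if "a \<le> b" for a b
  proof -
    have "(LINT t:{a..b}|lborel. f1 (- t)) = (LINT t:{-b..-a}|lborel. f1 t)"
      unfolding set_lebesgue_integral_def
      by (subst lborel_integral_real_affine[where c = "-1" and t = 0])
         (auto intro!: Bochner_Integration.integral_cong simp: indicator_def)
    then show ?thesis using assms that by (simp add: H1_rep_def set_lebesgue_integral_def)
  qed
  then show ?thesis using assms
    by (auto simp: H1_rep_def sq_int_reflect intro: sq_int_uminus[OF sq_int_reflect])
qed

text \<open>Near each x, on the window from x-1 to x+1, \<open>f\<close> is a constant plus an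
  indefinite integral of an integrable function.\<close>

lemma H1_rep_continuous:
  assumes "H1_rep f f1" shows "continuous_on UNIV f"
proof (rule continuous_at_imp_continuous_on, rule ballI)
  fix x :: real
  have int: "f1 absolutely_integrable_on {a..b}" for a b
    using sq_int_set_integrable[OF H1_rep_sq_int(2)[OF assms], of a b]
    by (simp add: set_integrable_def integrable_completion)
  have "continuous_on {x-1..x+1} (\<lambda>t. integral {x-1..t} f1)"
    by (intro indefinite_integral_continuous_1) (use int set_lebesgue_integral_eq_integral(1) in blast)
  moreover have "integral {x-1..t} f1 = f t - f (x-1)" if "t \<in> {x-1..x+1}" for t
    using assms that set_borel_integral_eq_integral(2)[OF sq_int_set_integrable[OF H1_rep_sq_int(2)[OF assms], of "x-1" t]]
    by (simp add: H1_rep_def)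
  ultimately have "continuous_on {x-1..x+1} (\<lambda>t. f t - f (x-1))"
    by (rule continuous_on_eq)
  then have "continuous_on {x-1..x+1} (\<lambda>t. f t - f (x-1) + f (x-1))"
    by (rule continuous_on_add[OF _ continuous_on_const])
  then have "continuous_on {x-1..x+1} f" by simp
  then have "continuous_on {x-1<..<x+1} f"
    by (rule continuous_on_subset) auto
  then show "isCont f x" by (simp add: continuous_on_eq_continuous_at)
qed

lemma H1_rep_has_vector_derivative:
  assumes "H1_rep f f1" "continuous_on UNIV f1"
  shows "(f has_vector_derivative f1 x) (at x)"
proof -
  have "((\<lambda>t. integral {x-1..t} f1) has_vector_derivative f1 x) (at x within {x-1..x+1})"
    by (intro integral_has_vector_derivative) (use assms in \<open>auto intro: continuous_on_subset\<close>)
  then have "((\<lambda>t. f t - f (x-1)) has_vector_derivative f1 x) (at x within {x-1..x+1})"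
  proof (rule has_vector_derivative_transform[rotated 2])
    show "f t - f (x-1) = integral {x-1..t} f1" if "t \<in> {x-1..x+1}" for t
      using assms that set_borel_integral_eq_integral(2)[OF sq_int_set_integrable[OF H1_rep_sq_int(2)[OF assms(1)], of "x-1" t]]
      by (simp add: H1_rep_def)
  qed auto
  then have "((\<lambda>t. f t - f (x-1) + f (x-1)) has_vector_derivative f1 x + 0) (at x within {x-1..x+1})"
    by (intro derivative_intros)
  moreover have "at x within {x-1..x+1} = at x"
    by (intro at_within_interior) auto
  ultimately show ?thesis by simp
qed

lemma H1_repI_deriv:
  assumes "sq_int f" "sq_int f1" "continuous_on UNIV f1" "\<And>x. (f has_vector_derivative f1 x) (at x)"
  shows "H1_rep f f1"
proof -
  have "(LINT t:{a..b}|lborel. f1 t) = f b - f a" if "a \<le> b" for a b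
  proof -
    have "(f1 has_integral (f b - f a)) {a..b}"
      by (rule fundamental_theorem_of_calculus[OF that]) (rule has_vector_derivative_at_within[OF assms(4)])
    then show ?thesis
      using set_borel_integral_eq_integral(2)[OF sq_int_set_integrable[OF assms(2)], of a b]
      by (simp add: integral_unique)
  qed
  then show ?thesis using assms by (simp add: H1_rep_def)
qed

lemma H1_rep_iff_interval_integral:
  assumes "sq_int f" "sq_int f1"
  shows "H1_rep f f1 \<longleftrightarrow> (\<forall>x. f x = f 0 + (LBINT t=ereal 0..ereal x. f1 t))"
proof
  assume H: "H1_rep f f1"
  show "\<forall>x. f x = f 0 + (LBINT t=ereal 0..ereal x. f1 t)"
  proof
    fix x :: real
    show "f x = f 0 + (LBINT t=ereal 0..ereal x. f1 t)"
    proof (cases "0 \<le> x")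
      case True
      then show ?thesis using H by (simp add: interval_integral_Icc H1_rep_def)
    next
      case False
      then have "(LBINT t=ereal 0..ereal x. f1 t) = - (LINT t:{x..0}|lborel. f1 t)"
        by (subst interval_integral_endpoints_reverse) (simp add: interval_integral_Icc)
      then show ?thesis using H False by (simp add: H1_rep_def)
    qed
  qed
next
  assume F: "\<forall>x. f x = f 0 + (LBINT t=ereal 0..ereal x. f1 t)"
  have "(LINT t:{a..b}|lborel. f1 t) = f b - f a" if "a \<le> b" for a b
  proof -
    have "(LBINT t=ereal 0..ereal a. f1 t) + (LBINT t=ereal a..ereal b. f1 t) = (LBINT t=ereal 0..ereal b. f1 t)"
    proof (rule interval_integral_sum)
      show "interval_lebesgue_integrable lborel (min (ereal 0) (min (ereal a) (ereal b)))
             (max (ereal 0) (max (ereal a) (ereal b))) f1"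
        unfolding ereal_min[symmetric] ereal_max[symmetric] interval_lebesgue_integrable_def
          einterval_eq
        by (auto intro!: set_integrable_subset[OF sq_int_set_integrable[OF assms(2), of "min 0 (min a b)" "max 0 (max a b)"]])
    qed
    then show ?thesis using F[rule_format, of a] F[rule_format, of b] that
      by (simp add: interval_integral_Icc algebra_simps)
  qed
  then show "H1_rep f f1" using assms by (simp add: H1_rep_def)
qed

text \<open>The pointwise derivative demanded by \<open>H2_rep\<close> comes for free:
  \<open>f1\<close> is itself in H1, hence continuous, so the fundamental theorem of calculus
  upgrades the integral identity for \<open>f\<close>.\<close>

lemma H2_rep_iff_H1_rep: "H2_rep f f2 \<longleftrightarrow> (\<exists>f1. H1_rep f f1 \<and> H1_rep f1 f2)"
proof
  assume "H2_rep f f2"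
  then obtain f1 where *: "sq_int f" "sq_int f2" "sq_int f1"
    "\<And>x. (f has_vector_derivative f1 x) (at x)"
    "\<forall>x. f1 x = f1 0 + (LBINT t=ereal 0..ereal x. f2 t)"
    unfolding H2_rep_def by blast
  then have "H1_rep f1 f2" using H1_rep_iff_interval_integral by blast
  then show "\<exists>f1. H1_rep f f1 \<and> H1_rep f1 f2"
    using * H1_repI_deriv H1_rep_continuous by blast
next
  assume "\<exists>f1. H1_rep f f1 \<and> H1_rep f1 f2"
  then obtain f1 where *: "H1_rep f f1" "H1_rep f1 f2" by blast
  show "H2_rep f f2" unfolding H2_rep_def
  proof (intro conjI exI[of _ f1] allI)
    show "(f has_vector_derivative f1 x) (at x)" for x
      by (rule H1_rep_has_vector_derivative[OF *(1) H1_rep_continuous[OF *(2)]])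
    show "f1 x = f1 0 + (LBINT t=ereal 0..ereal x. f2 t)" for x
      using H1_rep_iff_interval_integral[OF H1_rep_sq_int[OF *(2)]] *(2) by blast
  qed (use * in \<open>auto dest: H1_rep_sq_int\<close>)
qed

lemma H2_rep_sq_int: "H2_rep f f2 \<Longrightarrow> sq_int f" "H2_rep f f2 \<Longrightarrow> sq_int f2"
  by (auto simp: H2_rep_def)

lemma H2_rep_add: "H2_rep f f2 \<Longrightarrow> H2_rep g g2 \<Longrightarrow> H2_rep (\<lambda>x. f x + g x) (\<lambda>x. f2 x + g2 x)"
  unfolding H2_rep_iff_H1_rep by (blast intro: H1_rep_add)

lemma H2_rep_scale: "H2_rep f f2 \<Longrightarrow> H2_rep (\<lambda>x. c * f x) (\<lambda>x. c * f2 x)"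
  unfolding H2_rep_iff_H1_rep by (blast intro: H1_rep_scale)

subsection \<open>Convolution with one-sided exponentials\<close>

text \<open>The causal fundamental solution of u' + k u. It is polymorphic because the modulus of
  the complex version is the real version with rate \<open>Re k\<close>.\<close>

definition exp_step :: "'a::{real_normed_field,banach} \<Rightarrow> real \<Rightarrow> 'a" where
  "exp_step k t = (if 0 \<le> t then exp (- k * of_real t) else 0)"

lemma exp_step_measurable [measurable]:
  "(exp_step k :: real \<Rightarrow> 'a::{real_normed_field,banach,second_countable_topology}) \<in> borel_measurable borel"
proof -
  have [measurable]: "(\<lambda>t. exp (- k * of_real t)) \<in> borel_measurable borel"
    by (intro borel_measurable_continuous_onI continuous_intros)
  show ?thesis unfolding exp_step_def by measurable
qed

lemma norm_exp_step: "cmod (exp_step k t) = exp_step (Re k) t"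
  by (simp add: exp_step_def)

lemma exp_step_real_nonneg: "0 \<le> exp_step (r::real) t"
  by (simp add: exp_step_def)

lemma exp_step_real_le_1: "0 < r \<Longrightarrow> exp_step (r::real) t \<le> 1"
  by (simp add: exp_step_def)

lemma exp_step_real_has_integral:
  assumes "0 < (r::real)"
  shows "has_bochner_integral lborel (exp_step r) (1 / r)"
proof (rule has_bochner_integral_nn_integral)
  have "(\<integral>\<^sup>+ t. ennreal (exp_step r t) \<partial>lborel) = (\<integral>\<^sup>+ t. ennreal (exp (- r * t)) * indicator {0..} t \<partial>lborel)"
    by (intro nn_integral_cong) (auto simp: exp_step_def indicator_def)
  also have "\<dots> = 0 - (- exp (- r * 0) / r)"
  proof (rule nn_integral_FTC_atLeast)
    show "((\<lambda>t. - exp (- r * t) / r) has_real_derivative exp (- r * t)) (at t)" for t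
      using assms by (auto intro!: derivative_eq_intros)
    have "((\<lambda>t. exp (- r * t)) \<longlongrightarrow> 0) at_top"
      using assms by (intro filterlim_compose[OF exp_at_bot] filterlim_tendsto_neg_mult_at_bot[of _ "-r"] filterlim_ident) auto
    then show "((\<lambda>t. - exp (- r * t) / r) \<longlongrightarrow> 0) at_top"
      using tendsto_divide[OF tendsto_minus tendsto_const, of _ 0 at_top r] assms by fastforce
  qed auto
  finally show "(\<integral>\<^sup>+ t. ennreal (exp_step r t) \<partial>lborel) = ennreal (1 / r)" by simp
qed (use assms in \<open>auto simp: exp_step_real_nonneg\<close>)

lemma exp_step_real_has_integral_minus:
  assumes "0 < (r::real)"
  shows "has_bochner_integral lborel (\<lambda>y. exp_step r (x - y)) (1 / r)"
  using lborel_has_bochner_integral_real_affine_iff[of "-1" "exp_step r" "1/r" x] 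
    exp_step_real_has_integral[OF assms] by simp

lemma exp_step_real_has_integral_shift:
  assumes "0 < (r::real)"
  shows "has_bochner_integral lborel (\<lambda>x. exp_step r (x - y)) (1 / r)"
  using lborel_has_bochner_integral_real_affine_iff[of "1" "exp_step r" "1/r" "-y"] 
    exp_step_real_has_integral[OF assms] by simp

text \<open>Integrated form of E' = delta - k E for the step exponential E: the indicator records
  whether the unit jump at y lies in the interval. It is open at a because the step already has
  value 1 at 0.\<close>

lemma exp_step_set_integral:
  fixes k :: complex and a b y :: real
  assumes "k \<noteq> 0" "a \<le> b"
  shows "k * (LINT s:{a..b}|lborel. exp_step k (s - y)) =
    exp_step k (a - y) + indicator {a<..b} y - exp_step k (b - y)"
proof -
  let ?F = "\<lambda>s. - exp (- k * of_real (s - y)) / k"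
  have F: "(LINT s:{u..b}|lborel. exp (- k * of_real (s - y))) = ?F b - ?F u" if "u \<le> b" for u
    unfolding set_lebesgue_integral_def
  proof (rule integral_FTC_atLeastAtMost[OF that])
    show "(?F has_vector_derivative exp (- k * of_real (s - y))) (at s within {u..b})" for s
    proof -
      have "((\<lambda>z. - exp (- k * (z - of_real y)) / k) has_field_derivative exp (- k * (of_real s - of_real y))) (at (of_real s))"
        using assms by (auto intro!: derivative_eq_intros)
      then show ?thesis
        by (auto dest!: has_vector_derivative_real_field intro: has_vector_derivative_at_within)
    qed
  qed (intro continuous_intros)
  consider "y \<le> a" | "a < y" "y \<le> b" | "b < y" by linarith
  then show ?thesis
  proof cases
    case 1
    then have "(LINT s:{a..b}|lborel. exp_step k (s - y)) = (LINT s:{a..b}|lborel. exp (- k * of_real (s - y)))"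
      by (intro set_lebesgue_integral_cong) (auto simp: exp_step_def)
    then show ?thesis using 1 assms F[of a] by (simp add: exp_step_def field_simps)
  next
    case 2
    then have "(LINT s:{a..b}|lborel. exp_step k (s - y)) = (LINT s:{y..b}|lborel. exp (- k * of_real (s - y)))"
      unfolding set_lebesgue_integral_def
      by (intro Bochner_Integration.integral_cong) (auto simp: exp_step_def indicator_def)
    then show ?thesis using 2 assms F[of y] by (simp add: exp_step_def field_simps)
  next
    case 3
    then have "(LINT s:{a..b}|lborel. exp_step k (s - y)) = 0"
      unfolding set_lebesgue_integral_def
      by (intro integral_eq_zero_AE) (auto simp: exp_step_def indicator_def)
    then show ?thesis using 3 assms by (simp add: exp_step_def)
  qed
qed

definition exp_conv :: "complex \<Rightarrow> (real \<Rightarrow> complex) \<Rightarrow> real \<Rightarrow> complex" where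
  "exp_conv k g x = (LINT y|lborel. exp_step k (x - y) * g y)"

context
  fixes k :: complex and g :: "real \<Rightarrow> complex"
  assumes k: "0 < Re k" and g: "sq_int g"
begin

declare sq_int_measurable[OF g, measurable]

lemma exp_step_mult_sq_integrable:
  "integrable lborel (\<lambda>y. exp_step (Re k) (x - y) * (cmod (g y))\<^sup>2)"
  using exp_step_real_le_1[OF k]
  by (intro Bochner_Integration.integrable_bound[OF sq_int_integrable[OF g]])
     (auto intro!: AE_I2 simp: abs_mult exp_step_real_nonneg mult_left_le_one_le)

lemma exp_step_norm_integrable:
  "integrable lborel (\<lambda>y. exp_step (Re k) (x - y) * cmod (g y))"
proof (rule Bochner_Integration.integrable_bound)
  show "integrable lborel (\<lambda>y. exp_step (Re k) (x - y) + exp_step (Re k) (x - y) * (cmod (g y))\<^sup>2)"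
    using exp_step_real_has_integral_minus[OF k, of x] exp_step_mult_sq_integrable
    by (intro Bochner_Integration.integrable_add) (auto simp: has_bochner_integral_iff)
  have "cmod (g y) \<le> 1 + (cmod (g y))\<^sup>2" for y
    using sum_squares_bound[of "cmod (g y)" 1] norm_ge_zero[of "g y"]
    by (simp del: norm_ge_zero)
  then have "exp_step (Re k) (x - y) * cmod (g y) \<le> exp_step (Re k) (x - y) * (1 + (cmod (g y))\<^sup>2)" for y
    by (intro mult_left_mono exp_step_real_nonneg)
  then show "AE y in lborel. norm (exp_step (Re k) (x - y) * cmod (g y))
      \<le> norm (exp_step (Re k) (x - y) + exp_step (Re k) (x - y) * (cmod (g y))\<^sup>2)"
    by (intro AE_I2) (simp add: abs_mult exp_step_real_nonneg distrib_left)
qed measurable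

lemma exp_conv_integrable: "integrable lborel (\<lambda>y. exp_step k (x - y) * g y)"
  by (rule Bochner_Integration.integrable_bound[OF exp_step_norm_integrable[of x]])
     (auto simp: norm_mult norm_exp_step exp_step_real_nonneg)

lemma exp_conv_measurable [measurable]: "exp_conv k g \<in> borel_measurable borel"
proof -
  have "(\<lambda>x. LINT y|lborel. exp_step k (x - y) * g y) \<in> borel_measurable borel"
    by (rule sigma_finite_measure.borel_measurable_lebesgue_integral) (unfold_locales, measurable)
  then show ?thesis by (simp add: exp_conv_def[abs_def])
qed

text \<open>Cauchy--Schwarz for the weight \<open>exp_step\<close>: expand the square around the weighted mean.\<close>
lemma norm_exp_conv_weighted_le:
  "(LINT y|lborel. exp_step (Re k) (x - y) * cmod (g y))\<^sup>2
    \<le> 1 / Re k * (LINT y|lborel. exp_step (Re k) (x - y) * (cmod (g y))\<^sup>2)"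
proof -
  let ?e = "\<lambda>y. exp_step (Re k) (x - y)"
  let ?I = "LINT y|lborel. ?e y * cmod (g y)" and ?J = "LINT y|lborel. ?e y * (cmod (g y))\<^sup>2"
  define M where "M = Re k * ?I"
  have e: "integrable lborel ?e" "integral\<^sup>L lborel ?e = 1 / Re k"
    using exp_step_real_has_integral_minus[OF k, of x] by (auto simp: has_bochner_integral_iff)
  have "0 \<le> (LINT y|lborel. ?e y * (cmod (g y) - M)\<^sup>2)"
    by (intro integral_nonneg_AE AE_I2 mult_nonneg_nonneg exp_step_real_nonneg) auto
  also have "\<dots> = (LINT y|lborel. ?e y * (cmod (g y))\<^sup>2 - 2 * M * (?e y * cmod (g y)) + M\<^sup>2 * ?e y)"
    by (intro Bochner_Integration.integral_cong) (auto simp: power2_eq_square algebra_simps)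
  also have "\<dots> = ?J - 2 * M * ?I + M\<^sup>2 * (1 / Re k)"
    using e exp_step_mult_sq_integrable[of x] exp_step_norm_integrable[of x] by simp
  also have "\<dots> = ?J - Re k * ?I\<^sup>2"
    using k by (simp add: M_def power2_eq_square field_simps)
  finally show ?thesis using k by (simp add: field_simps)
qed

lemma norm_exp_conv_sq_le:
  "(cmod (exp_conv k g x))\<^sup>2 \<le> 1 / Re k * (LINT y|lborel. exp_step (Re k) (x - y) * (cmod (g y))\<^sup>2)"
proof -
  have "cmod (exp_conv k g x) \<le> (LINT y|lborel. cmod (exp_step k (x - y) * g y))"
    unfolding exp_conv_def by (rule integral_norm_bound)
  also have "\<dots> = (LINT y|lborel. exp_step (Re k) (x - y) * cmod (g y))"
    by (simp add: norm_mult norm_exp_step)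
  finally show ?thesis
    by (intro order_trans[OF power_mono norm_exp_conv_weighted_le]) auto
qed

text \<open>Fubini: integrating over x first, the weight contributes 1 / Re k for every y.\<close>

lemma exp_step_mult_sq_integral:
  "has_bochner_integral lborel (\<lambda>x. LINT y|lborel. exp_step (Re k) (x - y) * (cmod (g y))\<^sup>2)
    (1 / Re k * (LINT y|lborel. (cmod (g y))\<^sup>2))"
proof -
  let ?f = "\<lambda>y x. exp_step (Re k) (x - y) * (cmod (g y))\<^sup>2"
  have inner: "integrable lborel (?f y)" "integral\<^sup>L lborel (?f y) = 1 / Re k * (cmod (g y))\<^sup>2" for y
    using exp_step_real_has_integral_shift[OF k, of y] by (auto simp: has_bochner_integral_iff)
  have "integrable (lborel \<Otimes>\<^sub>M lborel) (\<lambda>(y, x). ?f y x)"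
    using inner sq_int_integrable[OF g]
    by (intro lborel_pair.Fubini_integrable) (auto simp: abs_mult exp_step_real_nonneg)
  from lborel_pair.integrable_snd[OF this] lborel_pair.Fubini_integral[OF this] show ?thesis
    unfolding inner(2) by (simp add: has_bochner_integral_iff)
qed

lemma exp_conv_sq_int: "sq_int (exp_conv k g)"
  by (rule sq_int_dominated[OF _ _ norm_exp_conv_sq_le])
     (use exp_step_mult_sq_integral in \<open>auto simp: has_bochner_integral_iff\<close>)

text \<open>A case of Young's inequality: one factor 1 / Re k in the squared norm comes from
  Cauchy-Schwarz, the other from Fubini.\<close>

lemma L2norm_exp_conv_le: "L2norm (exp_conv k g) \<le> 1 / Re k * L2norm g"
proof -
  let ?P = "\<lambda>x. LINT y|lborel. exp_step (Re k) (x - y) * (cmod (g y))\<^sup>2"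
  have P: "integrable lborel ?P" "integral\<^sup>L lborel ?P = 1 / Re k * (LINT y|lborel. (cmod (g y))\<^sup>2)"
    using exp_step_mult_sq_integral by (auto simp: has_bochner_integral_iff)
  have "(LINT x|lborel. (cmod (exp_conv k g x))\<^sup>2) \<le> (LINT x|lborel. 1 / Re k * ?P x)"
    by (intro integral_mono norm_exp_conv_sq_le sq_int_integrable exp_conv_sq_int integrable_mult_right P)
  also have "\<dots> = (1 / Re k)\<^sup>2 * (LINT y|lborel. (cmod (g y))\<^sup>2)"
    using P by (simp add: power2_eq_square)
  finally have "L2norm (exp_conv k g) \<le> sqrt ((1 / Re k)\<^sup>2 * (LINT y|lborel. (cmod (g y))\<^sup>2))"
    unfolding L2norm_def by (rule real_sqrt_le_mono)
  then show ?thesis using k by (simp add: real_sqrt_mult L2norm_def)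
qed

text \<open>The primitive of \<open>exp_conv k g\<close> is computed by exchanging the order of integration.\<close>
lemma exp_conv_H1_rep: "H1_rep (exp_conv k g) (\<lambda>x. g x - k * exp_conv k g x)"
proof -
  have "(LINT t:{a..b}|lborel. g t - k * exp_conv k g t) = exp_conv k g b - exp_conv k g a" if "a \<le> b" for a b
  proof -
    let ?f = "\<lambda>s y. indicator {a..b} s *\<^sub>R (exp_step k (s - y) * g y)"
    \<comment> \<open>\<open>?h\<close> is the inner integral of absolute values. It is square
      integrable by the weighted Cauchy-Schwarz bound, hence integrable on the bounded interval,
      which is what Fubini requires.\<close>
    let ?h = "\<lambda>s. LINT y|lborel. exp_step (Re k) (s - y) * cmod (g y)"
    have h_meas[measurable]: "?h \<in> borel_measurable borel"
      by (rule sigma_finite_measure.borel_measurable_lebesgue_integral) (unfold_locales, measurable)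
    have h: "sq_int (\<lambda>s. complex_of_real (?h s))"
      by (rule sq_int_dominated[OF _ _ order_trans[OF _ norm_exp_conv_weighted_le]])
         (use exp_step_mult_sq_integral in \<open>auto simp: has_bochner_integral_iff norm_of_real\<close>)
    have hn: "0 \<le> ?h s" for s
      by (intro integral_nonneg_AE AE_I2 mult_nonneg_nonneg exp_step_real_nonneg) auto
    have "integrable lborel (\<lambda>s. norm (indicator {a..b} s *\<^sub>R complex_of_real (?h s)))"
      using sq_int_set_integrable[OF h, of a b] unfolding set_integrable_def by (rule integrable_norm)
    then have "integrable lborel (\<lambda>s. LINT y|lborel. norm (?f s y))"
      using hn by (simp add: norm_mult norm_exp_step)
    then have "integrable (lborel \<Otimes>\<^sub>M lborel) (\<lambda>(s, y). ?f s y)"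
      by (intro lborel_pair.Fubini_integrable) (auto simp: exp_conv_integrable)
    from lborel_pair.Fubini_integral[OF this]
    have swap: "(LINT s:{a..b}|lborel. exp_conv k g s) = (LINT y|lborel. LINT s|lborel. ?f s y)"
      by (simp add: exp_conv_def set_lebesgue_integral_def)
    have "k * (LINT s:{a..b}|lborel. exp_conv k g s) = (LINT y|lborel. k * (LINT s|lborel. ?f s y))"
      unfolding swap by simp
    also have "\<dots> = (LINT y|lborel. exp_step k (a - y) * g y + indicator {a<..b} y *\<^sub>R g y - exp_step k (b - y) * g y)"
    proof (intro Bochner_Integration.integral_cong refl)
      fix y
      have "k * (LINT s|lborel. ?f s y) = k * (LINT s:{a..b}|lborel. exp_step k (s - y)) * g y"
        by (simp add: set_lebesgue_integral_def flip: mult_scaleR_left)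
      also have "\<dots> = (exp_step k (a - y) + indicator {a<..b} y - exp_step k (b - y)) * g y"
        using k that by (subst exp_step_set_integral) auto
      finally show "k * (LINT s|lborel. ?f s y) =
          exp_step k (a - y) * g y + indicator {a<..b} y *\<^sub>R g y - exp_step k (b - y) * g y"
        by (auto simp: algebra_simps indicator_def)
    qed
    also have "\<dots> = exp_conv k g a + (LINT y:{a<..b}|lborel. g y) - exp_conv k g b"
    proof -
      have "integrable lborel (\<lambda>y. indicat_real {a<..b} y *\<^sub>R g y)"
        using set_integrable_subset[OF sq_int_set_integrable[OF g, of a b], of "{a<..b}"]
        by (simp add: set_integrable_def greaterThanAtMost_subseteq_atLeastAtMost_iff)
      then show ?thesis
        by (simp add: exp_conv_def set_lebesgue_integral_def exp_conv_integrable)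
    qed
    also have "(LINT y:{a<..b}|lborel. g y) = (LINT y:{a..b}|lborel. g y)"
      by (rule set_integral_discrete_difference[where X = "{a}"]) auto
    finally show ?thesis
      using sq_int_set_integrable[OF g, of a b] sq_int_set_integrable[OF exp_conv_sq_int, of a b]
      by (simp add: set_integral_diff algebra_simps)
  qed
  then show ?thesis
    using g exp_conv_sq_int by (auto simp: H1_rep_def intro!: sq_int_diff sq_int_scale)
qed

end

subsection \<open>The resolvent of the second derivative\<close>

text \<open>Convolution with exp(-k|x|) / (2k), the inverse of k^2 - d^2/dx^2 on L2. The half of the
  kernel that looks to the right is the causal convolution conjugated by reflection.\<close>

definition green :: "complex \<Rightarrow> (real \<Rightarrow> complex) \<Rightarrow> real \<Rightarrow> complex" where
  "green k g x = (exp_conv k g x + exp_conv k (\<lambda>y. g (- y)) (- x)) / (2 * k)"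

text \<open>The halves satisfy T' = g - k T and S' = k S - g. In the derivative of T + S the rough
  term g cancels, leaving k(S - T), which can be differentiated once more.\<close>

lemma green_H2_rep:
  assumes "0 < Re k" "sq_int g"
  shows "H2_rep (green k g) (\<lambda>x. k\<^sup>2 * green k g x - g x)"
proof -
  have k: "k \<noteq> 0" using assms by auto
  let ?T = "exp_conv k g" and ?S = "\<lambda>x. exp_conv k (\<lambda>y. g (- y)) (- x)"
  have T: "H1_rep ?T (\<lambda>x. g x - k * ?T x)"
    by (rule exp_conv_H1_rep[OF assms])
  have S: "H1_rep ?S (\<lambda>x. - (g x - k * ?S x))"
    using H1_rep_reflect[OF exp_conv_H1_rep[OF assms(1) sq_int_reflect[OF assms(2)]]] by simp
  have "H1_rep (green k g) (\<lambda>x. (?S x - ?T x) / 2)"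
    using H1_rep_scale[OF H1_rep_add[OF T S], of "1 / (2 * k)"] k
    by (simp add: green_def[abs_def] add_divide_distrib diff_divide_distrib)
  moreover have "H1_rep (\<lambda>x. (?S x - ?T x) / 2) (\<lambda>x. k\<^sup>2 * green k g x - g x)"
  proof -
    have "1/2 * ?S x + - 1/2 * ?T x = (?S x - ?T x) / 2"
      "1/2 * - (g x - k * ?S x) + - 1/2 * (g x - k * ?T x) = k\<^sup>2 * green k g x - g x" for x
      using k by (simp_all add: green_def field_simps power2_eq_square)
    then show ?thesis
      using H1_rep_add[OF H1_rep_scale[OF S, of "1/2"] H1_rep_scale[OF T, of "-1/2"]] by presburger
  qed
  ultimately show ?thesis unfolding H2_rep_iff_H1_rep by blast
qed

lemma L2norm_green_le:
  assumes "0 < Re k" "sq_int g"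
  shows "L2norm (green k g) \<le> 2 / (cmod k * Re k) * L2norm g"
proof -
  let ?T = "exp_conv k g" and ?S = "\<lambda>x. exp_conv k (\<lambda>y. g (- y)) (- x)"
  have k: "k \<noteq> 0" using assms by auto
  have "L2norm (green k g) = L2norm (\<lambda>x. 1 / (2 * k) * (?T x + ?S x))"
    by (simp add: green_def[abs_def])
  also have "\<dots> = 1 / (2 * cmod k) * L2norm (\<lambda>x. ?T x + ?S x)"
    by (simp only: L2norm_scale norm_divide norm_mult) simp
  also have "\<dots> \<le> 1 / (2 * cmod k) * (2 * (L2norm ?T + L2norm ?S))"
    using assms by (intro mult_left_mono L2norm_add_le sq_int_reflect exp_conv_sq_int) auto
  also have "\<dots> \<le> 1 / (2 * cmod k) * (2 * (1 / Re k * L2norm g + 1 / Re k * L2norm g))"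
  proof (intro mult_left_mono add_mono)
    show "L2norm ?T \<le> 1 / Re k * L2norm g" by (rule L2norm_exp_conv_le[OF assms])
    show "L2norm ?S \<le> 1 / Re k * L2norm g"
      using L2norm_exp_conv_le[OF assms(1) sq_int_reflect[OF assms(2)]]
      by (simp add: L2norm_reflect L2norm_reflect[of "exp_conv k (\<lambda>y. g (- y))"])
  qed auto
  also have "\<dots> = 2 / (cmod k * Re k) * L2norm g"
    using k assms by (simp add: field_simps)
  finally show ?thesis .
qed

section \<open>The kernel convolution as a Green operator\<close>

lemma conv_kernel_eq_green:
  assumes "0 < \<alpha>" "sq_int f"
  shows "conv (kernel \<alpha>) f x = (complex_of_real \<alpha>)\<^sup>2 * green (complex_of_real \<alpha>) f x"
proof -
  let ?k = "complex_of_real \<alpha>"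
  have k: "0 < Re ?k" using assms by simp
  have r: "exp_conv ?k (\<lambda>y. f (- y)) (- x) = (LINT y|lborel. exp_step ?k (y - x) * f y)"
    unfolding exp_conv_def
    by (subst lborel_integral_real_affine[where c = "-1" and t = 0]) auto
  have i: "integrable lborel (\<lambda>y. exp_step ?k (y - x) * f y)"
    using lborel_integrable_real_affine[OF exp_conv_integrable[OF k sq_int_reflect[OF assms(2)], of "-x"], of "-1" 0]
    by simp
  have [measurable]: "f \<in> borel_measurable borel" using assms(2) by (rule sq_int_measurable)
  have "conv (kernel \<alpha>) f x = (LINT y|lborel. ?k / 2 * (exp_step ?k (x - y) * f y + exp_step ?k (y - x) * f y))"
    unfolding conv_def
  proof (rule integral_cong_AE)
    \<comment> \<open>At y = x both one-sided steps equal 1, so the decomposition fails there; a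
      single point is a null set.\<close>
    have "complex_of_real (kernel \<alpha> (x - y)) = ?k / 2 * (exp_step ?k (x - y) + exp_step ?k (y - x))" if "y \<noteq> x" for y
      using that by (auto simp: kernel_def exp_step_def exp_of_real simp flip: of_real_mult of_real_minus of_real_diff)
    then have "complex_of_real (kernel \<alpha> (x - y)) * f y = ?k / 2 * (exp_step ?k (x - y) * f y + exp_step ?k (y - x) * f y)" if "y \<noteq> x" for y
      using that by (simp add: algebra_simps)
    then show "AE y in lborel. complex_of_real (kernel \<alpha> (x - y)) * f y = ?k / 2 * (exp_step ?k (x - y) * f y + exp_step ?k (y - x) * f y)"
      by (intro eventually_mono[OF AE_lborel_singleton[of x]])
    show "(\<lambda>y. complex_of_real (kernel \<alpha> (x - y)) * f y) \<in> borel_measurable lborel"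
      unfolding kernel_def by measurable
  qed measurable
  also have "\<dots> = ?k / 2 * (exp_conv ?k f x + exp_conv ?k (\<lambda>y. f (- y)) (- x))"
    unfolding r unfolding exp_conv_def using i exp_conv_integrable[OF k assms(2), of x] by simp
  also have "\<dots> = ?k\<^sup>2 * green ?k f x"
    using assms by (simp add: green_def power2_eq_square)
  finally show ?thesis .
qed

section \<open>Uniqueness of square-integrable solutions\<close>

lemma sq_int_exp_eq_0:
  assumes "sq_int (\<lambda>x. c * exp (k * of_real x))" "0 < Re k"
  shows "c = 0"
proof (rule ccontr)
  assume c: "c \<noteq> 0"
  let ?I = "LINT x|lborel. (cmod (c * exp (k * of_real x)))\<^sup>2"
  \<comment> \<open>For x \<ge> 0 the integrand is at least |c|^2, so the integral over [0, n] grows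
    without bound in n.\<close>
  have "real n * (cmod c)\<^sup>2 \<le> ?I" for n
  proof -
    have "(LINT x|lborel. indicator {0..real n} x * (cmod c)\<^sup>2) \<le> ?I"
    proof (rule integral_mono)
      show "indicator {0..real n} x * (cmod c)\<^sup>2 \<le> (cmod (c * exp (k * of_real x)))\<^sup>2" for x
        using assms(2) by (auto simp: indicator_def norm_mult power_mult_distrib mult_le_cancel_left1 one_le_power)
    qed (use assms(1) in \<open>auto simp: sq_int_def intro!: integrable_real_indicator\<close>)
    then show ?thesis by simp
  qed
  moreover obtain n where "?I / (cmod c)\<^sup>2 < real n" using reals_Archimedean2 by blast
  ultimately show False using c by (fastforce simp: field_simps not_le[symmetric])
qed

text \<open>The integrating factor exp(-k x) shows that z is a multiple of exp(k x). This grows at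
  one end of the line, and reflection reduces the case Re k < 0 to growth at plus infinity.\<close>

lemma sq_int_exponential_ode_eq_0:
  assumes z: "sq_int z" and d: "\<And>x. (z has_vector_derivative k * z x) (at x)" and k: "Re k \<noteq> 0"
  shows "z x = 0"
proof -
  have "((\<lambda>x. z x * exp (- k * of_real x)) has_vector_derivative 0) (at x)" for x
  proof -
    have "((\<lambda>w. exp (- k * w)) has_field_derivative - k * exp (- k * of_real x)) (at (of_real x))"
      by (auto intro!: derivative_eq_intros)
    then have "((\<lambda>x. exp (- k * of_real x)) has_vector_derivative - k * exp (- k * of_real x)) (at x)"
      by (rule has_vector_derivative_real_field)
    from has_vector_derivative_mult[OF d[of x] this] show ?thesis by (simp add: algebra_simps)
  qed
  then obtain c where c: "\<And>x. z x * exp (- k * of_real x) = c"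
    using has_vector_derivative_zero_constant[of UNIV "\<lambda>x. z x * exp (- k * of_real x)"] by auto
  have z_eq: "z = (\<lambda>x. c * exp (k * of_real x))"
  proof
    fix x show "z x = c * exp (k * of_real x)"
      unfolding c[of x, symmetric] by (simp add: mult.assoc flip: exp_add)
  qed
  have "c = 0"
  proof (cases "0 < Re k")
    case True
    then show ?thesis using sq_int_exp_eq_0 z z_eq by blast
  next
    case False
    then show ?thesis
      using sq_int_exp_eq_0[of c "-k"] sq_int_reflect[OF z] k by (simp add: z_eq)
  qed
  then show ?thesis by (simp add: z_eq)
qed

text \<open>Factor w'' - k^2 w: for l = k and for l = -k, the function w' - l w solves z' = -l z and
  is square integrable, hence zero. So w' equals both k w and -k w.\<close>

lemma H2_rep_ode_eq_0:
  assumes "0 < Re k" "H2_rep w (\<lambda>x. k\<^sup>2 * w x)"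
  shows "w x = 0"
proof -
  obtain w1 where w1: "H1_rep w w1" "H1_rep w1 (\<lambda>x. k\<^sup>2 * w x)"
    using assms(2) unfolding H2_rep_iff_H1_rep by blast
  note d = H1_rep_has_vector_derivative[OF w1(1) H1_rep_continuous[OF w1(2)]]
  have d1: "(w1 has_vector_derivative k\<^sup>2 * w x) (at x)" for x
    by (rule H1_rep_has_vector_derivative[OF w1(2)])
       (intro continuous_intros H1_rep_continuous[OF w1(1)])
  have z: "w1 x - l * w x = 0" if l: "l\<^sup>2 = k\<^sup>2" "Re l \<noteq> 0" for l
  proof (rule sq_int_exponential_ode_eq_0[of "\<lambda>x. w1 x - l * w x" "-l"])
    show "sq_int (\<lambda>x. w1 x - l * w x)"
      using w1 by (intro sq_int_diff sq_int_scale) (auto dest: H1_rep_sq_int)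
    show "((\<lambda>x. w1 x - l * w x) has_vector_derivative - l * (w1 x - l * w x)) (at x)" for x
    proof -
      have "((\<lambda>x. w1 x - l * w x) has_vector_derivative k\<^sup>2 * w x - l * w1 x) (at x)"
        by (intro has_vector_derivative_diff d1 has_vector_derivative_mult_right d)
      moreover have "k\<^sup>2 * w x - l * w1 x = - l * (w1 x - l * w x)"
        unfolding l(1)[symmetric] by (simp add: algebra_simps power2_eq_square)
      ultimately show ?thesis by simp
    qed
  qed (use l in auto)
  from z[of k] z[of "-k"] assms(1) have "w1 x = k * w x" "w1 x = - (k * w x)"
    by (auto simp: eq_neg_iff_add_eq_0)
  then have "2 * (k * w x) = 0" by simp
  then show ?thesis using assms(1) by auto
qed

text \<open>The Green solution and \<open>f\<close> solve the same equation, so their difference is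
  a square-integrable homogeneous solution.\<close>

lemma green_left_inverse:
  assumes "0 < Re k" "H2_rep f f2"
  shows "green k (\<lambda>x. k\<^sup>2 * f x - f2 x) x = f x"
proof -
  let ?g = "\<lambda>x. k\<^sup>2 * f x - f2 x"
  have "sq_int ?g"
    using assms(2) by (intro sq_int_diff sq_int_scale) (auto dest: H2_rep_sq_int)
  from H2_rep_add[OF green_H2_rep[OF assms(1) this] H2_rep_scale[OF assms(2), of "-1"]]
  have "H2_rep (\<lambda>x. green k ?g x - f x) (\<lambda>x. k\<^sup>2 * (green k ?g x - f x))"
    by (simp add: algebra_simps)
  from H2_rep_ode_eq_0[OF assms(1) this] show ?thesis by simp
qed

text \<open>Identifies the convolution from its differential equation alone, so no convolution
  integral has to be evaluated for explicitly constructed functions.\<close>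

lemma conv_kernel_unique:
  assumes "0 < \<alpha>" "H2_rep h (\<lambda>x. (complex_of_real \<alpha>)\<^sup>2 * (h x - f x))" "sq_int f"
  shows "conv (kernel \<alpha>) f = h"
proof
  fix x
  let ?k = "complex_of_real \<alpha>"
  have "exp_conv ?k (\<lambda>x. c * g x) y = c * exp_conv ?k g y" for c g y
    by (simp add: exp_conv_def mult.left_commute[of _ c])
  then have "green ?k (\<lambda>x. ?k\<^sup>2 * f x) x = ?k\<^sup>2 * green ?k f x"
    by (simp add: green_def distrib_left)
  moreover have "green ?k (\<lambda>x. ?k\<^sup>2 * f x) x = h x"
    using green_left_inverse[OF _ assms(2), of ?k x] assms(1) by (simp add: algebra_simps)
  ultimately show "conv (kernel \<alpha>) f x = h x"
    by (simp add: conv_kernel_eq_green assms)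
qed

lemma conv_kernel_H2_rep:
  assumes "0 < \<alpha>" "sq_int f"
  shows "H2_rep (conv (kernel \<alpha>) f) (\<lambda>x. (complex_of_real \<alpha>)\<^sup>2 * (conv (kernel \<alpha>) f x - f x))"
  using H2_rep_scale[OF green_H2_rep[of "complex_of_real \<alpha>" f], of "(complex_of_real \<alpha>)\<^sup>2"] assms
    conv_kernel_eq_green[OF assms, abs_def]
  by simp

subsection \<open>Values outside the range of the symbol\<close>

text \<open>The principal root has nonnegative real part; if that part were zero, its square would
  lie on the closed negative real axis.\<close>

lemma complex_square_root_Re_pos:
  assumes "\<And>s::real. 0 \<le> s \<Longrightarrow> z \<noteq> - complex_of_real s"
  obtains k where "0 < Re k" "k\<^sup>2 = z"
proof
  show sq: "(csqrt z)\<^sup>2 = z" by simp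
  have "Re (csqrt z) \<noteq> 0"
  proof
    assume "Re (csqrt z) = 0"
    then have "z = - complex_of_real ((Im (csqrt z))\<^sup>2)"
      by (subst sq[symmetric]) (simp add: complex_eq_iff power2_eq_square)
    then show False using assms[of "(Im (csqrt z))\<^sup>2"] by simp
  qed
  then show "0 < Re (csqrt z)" using Re_csqrt[of z] by linarith
qed

lemma complex_quadratic_root:
  fixes A B C :: complex
  assumes "A \<noteq> 0"
  obtains z where "A * z\<^sup>2 + B * z + C = 0"
proof
  let ?D = "csqrt (B\<^sup>2 - 4 * A * C)"
  have D: "?D\<^sup>2 = B\<^sup>2 - 4 * A * C" by simp
  have "4 * A * (A * ((?D - B) / (2 * A))\<^sup>2 + B * ((?D - B) / (2 * A)) + C) = ?D\<^sup>2 - (B\<^sup>2 - 4 * A * C)"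
    using assms by (simp add: field_simps power2_eq_square del: power2_csqrt)
  then show "A * ((?D - B) / (2 * A))\<^sup>2 + B * ((?D - B) / (2 * A)) + C = 0"
    using assms D by simp
qed

text \<open>With \<open>h = \<phi> * \<psi>\<close> the equation \<open>(L - \<mu>) \<psi> = g\<close> is a constant-coefficient system for
  \<open>(\<psi>, h)\<close>. The root \<open>\<theta>\<close> makes \<open>p = \<psi> + \<theta> h\<close> satisfy a scalar equation
  \<open>p'' = z\<^sub>1 p - g / d\<close>, after which \<open>h'' = z\<^sub>2 h - \<alpha>\<^sup>2 p\<close>; here \<open>- z\<^sub>1\<close> and \<open>- z\<^sub>2\<close> are the
  two roots of the quadratic in the assumption.\<close>
lemma resolvent_setI:
  assumes d: "0 < d" and \<alpha>: "0 < \<alpha>"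
    and no_root: "\<And>s::real. 0 \<le> s \<Longrightarrow>
      of_real d * (of_real s)\<^sup>2 + (of_real (d * \<alpha>\<^sup>2 - b) - \<mu>) * of_real s + (of_real (c\<^sup>2 - b) - \<mu>) * of_real (\<alpha>\<^sup>2) \<noteq> 0"
  shows "\<mu> \<in> resolvent_set d c b (kernel \<alpha>)"
proof -
  define D B M C where "D = complex_of_real d" and "B = (complex_of_real \<alpha>)\<^sup>2"
    and "M = complex_of_real b + \<mu>" and "C = (complex_of_real c)\<^sup>2"
  note defs = D_def B_def M_def C_def
  have nz: "D \<noteq> 0" "B \<noteq> 0" using d \<alpha> by (auto simp: defs)
  \<comment> \<open>With f'' = (C h - M f - g) / D and h'' = B (h - f), the f-coefficient of (f +
    \<theta> h)'' is \<open>z1\<close>. Requiring the h-coefficient to be \<theta> times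
    \<open>z1\<close> gives this quadratic for \<theta>.\<close>
  obtain \<theta> where \<theta>: "D * B * \<theta>\<^sup>2 + (D * B + M) * \<theta> + C = 0"
    using complex_quadratic_root[of "D * B"] nz by auto
  define z1 z2 where "z1 = - M / D - \<theta> * B" and "z2 = B * (1 + \<theta>)"
  have Dz1: "D * z1 = - M - D * \<theta> * B" using nz by (simp add: z1_def field_simps)
  \<comment> \<open>The hypothesis under z = -s: no root of the characteristic quadratic lies on the
    closed negative real axis, so \<open>z1\<close> and \<open>z2\<close> have square roots with
    positive real part.\<close>
  have no_root': "D * z\<^sup>2 - (D * B - M) * z + (C - M) * B \<noteq> 0" if "0 \<le> s" "z = - complex_of_real s" for s z
    using no_root[OF that(1)] by (simp add: that(2) defs algebra_simps)
  have "D * (D * z1\<^sup>2 - (D * B - M) * z1 + (C - M) * B) = (D * z1)\<^sup>2 - (D * B - M) * (D * z1) + D * (C - M) * B"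
    by (simp add: algebra_simps power2_eq_square)
  also have "\<dots> = D * B * (D * B * \<theta>\<^sup>2 + (D * B + M) * \<theta> + C)"
    unfolding Dz1 by (simp add: algebra_simps power2_eq_square)
  finally have "D * z1\<^sup>2 - (D * B - M) * z1 + (C - M) * B = 0" using \<theta> nz by simp
  then obtain k1 where k1: "0 < Re k1" "k1\<^sup>2 = z1"
    using complex_square_root_Re_pos[of z1] no_root' by metis
  have "D * z2\<^sup>2 - (D * B - M) * z2 + (C - M) * B = B * (D * B * \<theta>\<^sup>2 + (D * B + M) * \<theta> + C)"
    unfolding z2_def by (simp add: algebra_simps power2_eq_square)
  then have "D * z2\<^sup>2 - (D * B - M) * z2 + (C - M) * B = 0" using \<theta> by simp
  then obtain k2 where k2: "0 < Re k2" "k2\<^sup>2 = z2"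
    using complex_square_root_Re_pos[of z2] no_root' by metis
  have Lop: "Lop d c b (kernel \<alpha>) f f2 x - \<mu> * f x = - D * f2 x + C * conv (kernel \<alpha>) f x - M * f x" for f f2 x
    by (simp add: Lop_def defs algebra_simps)

  have "\<exists>f f2. H2_rep f f2 \<and> (AE x in lborel. Lop d c b (kernel \<alpha>) f f2 x - \<mu> * f x = g x)" if g: "sq_int g" for g
  proof -
    \<comment> \<open>The triangular system is solved in order: p from g, then h from p, and finally
      f = p - \<theta> h.\<close>
    define p where "p = green k1 (\<lambda>x. 1 / D * g x)"
    define h where "h = green k2 (\<lambda>x. B * p x)"
    define f where "f = (\<lambda>x. p x + (- \<theta>) * h x)"
    define f2 where "f2 = (\<lambda>x. (z1 * p x - 1 / D * g x) + (- \<theta>) * (z2 * h x - B * p x))"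
    have p: "H2_rep p (\<lambda>x. z1 * p x - 1 / D * g x)"
      using green_H2_rep[OF k1(1) sq_int_scale[OF g, of "1 / D"]] by (simp only: p_def k1(2))
    have h: "H2_rep h (\<lambda>x. z2 * h x - B * p x)"
      using green_H2_rep[OF k2(1) sq_int_scale[OF H2_rep_sq_int(1)[OF p], of B]] by (simp only: h_def k2(2))
    have f: "H2_rep f f2"
      unfolding f_def f2_def by (rule H2_rep_add[OF p H2_rep_scale[OF h]])
    \<comment> \<open>In terms of f the equation for h is the one characterising the convolution,
      which closes the loop: h really is the convolution of f.\<close>
    have "z2 * h x - B * p x = B * (h x - f x)" for x
      by (simp add: z2_def f_def algebra_simps)
    then have conv: "conv (kernel \<alpha>) f = h"
      using h by (intro conv_kernel_unique[OF \<alpha> _ H2_rep_sq_int(1)[OF f]]) (simp add: B_def)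
    have "- D * f2 x + C * h x - M * f x = g x" for x
    proof -
      have "- D * f2 x + C * h x - M * f x = - (D * z1) * p x + D * (1 / D) * g x
          + D * \<theta> * (z2 * h x - B * p x) + C * h x - M * f x"
        by (simp add: f2_def algebra_simps)
      also have "\<dots> = g x + (D * B * \<theta>\<^sup>2 + (D * B + M) * \<theta> + C) * h x"
        unfolding Dz1 using nz by (simp add: f_def z2_def algebra_simps power2_eq_square)
      finally show ?thesis using \<theta> by simp
    qed
    then show ?thesis using f by (intro exI[of _ f] exI[of _ f2]) (simp add: Lop conv)
  qed
  \<comment> \<open>The a priori bound runs the decoupling backwards: for arbitrary f in H2, p and h
    are recovered from g and p by the left-inverse property, and the norm bounds for the two Green
    operators are chained.\<close>
  moreover have "\<exists>K. \<forall>f f2. H2_rep f f2 \<longrightarrow> L2norm f \<le> K * L2norm (\<lambda>x. Lop d c b (kernel \<alpha>) f f2 x - \<mu> * f x)"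
  proof -
    define K1 K2 where "K1 = 2 / (cmod k1 * Re k1)" and "K2 = 2 / (cmod k2 * Re k2)"
    have K: "0 \<le> K1" "0 \<le> K2" using k1 k2 by (auto simp: K1_def K2_def)
    define K where "K = 2 * (1 + cmod \<theta> * K2 * cmod B) * K1 * cmod (1 / D)"
    have "L2norm f \<le> K * L2norm (\<lambda>x. Lop d c b (kernel \<alpha>) f f2 x - \<mu> * f x)" if f: "H2_rep f f2" for f f2
    proof -
      define h where "h = conv (kernel \<alpha>) f"
      define g where "g = (\<lambda>x. - D * f2 x + C * h x - M * f x)"
      define p where "p = (\<lambda>x. f x + \<theta> * h x)"
      have h: "H2_rep h (\<lambda>x. B * (h x - f x))"
        unfolding h_def B_def by (rule conv_kernel_H2_rep[OF \<alpha> H2_rep_sq_int(1)[OF f]])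
      have p: "H2_rep p (\<lambda>x. f2 x + \<theta> * (B * (h x - f x)))"
        unfolding p_def by (rule H2_rep_add[OF f H2_rep_scale[OF h]])
      have sq: "sq_int f" "sq_int f2" "sq_int h" "sq_int p"
        using f h p by (auto dest: H2_rep_sq_int)
      have "sq_int (\<lambda>x. - D * f2 x + C * h x - M * f x)"
        by (intro sq_int_diff sq_int_add sq_int_scale sq)
      then have g: "sq_int g" by (simp add: g_def)
      have "k1\<^sup>2 * p x - (f2 x + \<theta> * (B * (h x - f x))) = 1 / D * g x" for x
      proof -
        have "D * (k1\<^sup>2 * p x - (f2 x + \<theta> * (B * (h x - f x))))
            = (D * z1) * p x - D * f2 x - D * \<theta> * B * (h x - f x)"
          unfolding k1(2) by (simp add: algebra_simps)
        also have "\<dots> = g x - (D * B * \<theta>\<^sup>2 + (D * B + M) * \<theta> + C) * h x"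
          unfolding Dz1 by (simp add: g_def p_def algebra_simps power2_eq_square)
        finally have "D * (k1\<^sup>2 * p x - (f2 x + \<theta> * (B * (h x - f x)))) = g x"
          using \<theta> by simp
        then show ?thesis using nz by (simp add: eq_divide_eq mult.commute)
      qed
      with green_left_inverse[OF k1(1) p] have "p = green k1 (\<lambda>x. 1 / D * g x)" by (auto simp: fun_eq_iff)
      then have "L2norm p \<le> K1 * L2norm (\<lambda>x. 1 / D * g x)"
        using L2norm_green_le[OF k1(1) sq_int_scale[OF g, of "1 / D"]] by (simp only: K1_def)
      then have np: "L2norm p \<le> K1 * (cmod (1 / D) * L2norm g)" unfolding L2norm_scale .
      have "k2\<^sup>2 * h x - B * (h x - f x) = B * p x" for x
        unfolding k2(2) by (simp add: z2_def p_def algebra_simps)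
      with green_left_inverse[OF k2(1) h] have "h = green k2 (\<lambda>x. B * p x)" by (auto simp: fun_eq_iff)
      then have "L2norm h \<le> K2 * L2norm (\<lambda>x. B * p x)"
        using L2norm_green_le[OF k2(1) sq_int_scale[OF sq(4), of B]] by (simp only: K2_def)
      then have nh: "L2norm h \<le> K2 * (cmod B * L2norm p)" unfolding L2norm_scale .
      have "f = (\<lambda>x. p x + (- \<theta>) * h x)" by (simp add: p_def)
      then have "L2norm f \<le> 2 * (L2norm p + L2norm (\<lambda>x. (- \<theta>) * h x))"
        using L2norm_add_le[OF sq(4) sq_int_scale[OF sq(3), of "- \<theta>"]] by simp
      also have "\<dots> = 2 * (L2norm p + cmod \<theta> * L2norm h)"
        unfolding L2norm_scale by simp
      also have "\<dots> \<le> 2 * (L2norm p + cmod \<theta> * (K2 * (cmod B * L2norm p)))"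
        using nh by (intro mult_left_mono add_left_mono) auto
      also have "\<dots> = 2 * (1 + cmod \<theta> * K2 * cmod B) * L2norm p"
        by (simp add: algebra_simps)
      also have "\<dots> \<le> 2 * (1 + cmod \<theta> * K2 * cmod B) * (K1 * (cmod (1 / D) * L2norm g))"
        using K np by (intro mult_left_mono) auto
      also have "\<dots> = K * L2norm g" by (simp add: K_def mult_ac)
      finally show ?thesis by (simp add: Lop g_def h_def)
    qed
    then show ?thesis by blast
  qed
  ultimately show ?thesis by (simp add: resolvent_set_def)
qed

text \<open>The symbol of \<open>L\<close> at frequency \<open>\<xi>\<close> is \<open>q (\<xi>\<^sup>2) / (\<alpha>\<^sup>2 + \<xi>\<^sup>2)\<close> for the quadratic \<open>q\<close> below.\<close>
definition symbol_numerator :: "real \<Rightarrow> real \<Rightarrow> real \<Rightarrow> real \<Rightarrow> real \<Rightarrow> real" where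
  "symbol_numerator d c b \<alpha> s = d * s\<^sup>2 + (d * \<alpha>\<^sup>2 - b) * s + (c\<^sup>2 - b) * \<alpha>\<^sup>2"

text \<open>A spectral value, a priori complex, must make the quadratic vanish at some s \<ge> 0.
  The equation is linear in \<mu> with positive real coefficient \<alpha>^2 + s, so \<mu> is the
  real symbol value at s.\<close>

lemma spectrally_stableI:
  assumes "0 < d" "0 < \<alpha>" "\<And>s. 0 \<le> s \<Longrightarrow> 0 \<le> symbol_numerator d c b \<alpha> s"
  shows "spectrally_stable d c b (kernel \<alpha>)"
  unfolding spectrally_stable_def spectrum_L_def
proof (rule subsetI, rule ccontr)
  fix \<mu> assume "\<mu> \<in> - resolvent_set d c b (kernel \<alpha>)" and \<mu>: "\<mu> \<notin> complex_of_real ` {0..}"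
  then obtain s where s: "0 \<le> s" and eq: "of_real d * (of_real s)\<^sup>2 + (of_real (d * \<alpha>\<^sup>2 - b) - \<mu>) * of_real s
      + (of_real (c\<^sup>2 - b) - \<mu>) * of_real (\<alpha>\<^sup>2) = 0"
    using resolvent_setI[OF assms(1,2)] by blast
  have pos: "0 < \<alpha>\<^sup>2 + s" using assms(2) s by (simp add: add_pos_nonneg)
  have "\<mu> * complex_of_real (\<alpha>\<^sup>2 + s) = complex_of_real (symbol_numerator d c b \<alpha> s)"
    using eq by (simp add: symbol_numerator_def algebra_simps)
  then have "\<mu> = complex_of_real (symbol_numerator d c b \<alpha> s / (\<alpha>\<^sup>2 + s))"
    using pos by (simp add: nonzero_eq_divide_eq del: of_real_add)
  moreover have "0 \<le> symbol_numerator d c b \<alpha> s / (\<alpha>\<^sup>2 + s)"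
    using assms(3)[OF s] pos by simp
  ultimately show False using \<mu> by blast
qed

subsection \<open>Approximate eigenfunctions\<close>

text \<open>A plane wave with amplitude (x + iN)^(-j). The pole lies off the real line, and the
  exponent j makes the span of these functions closed under differentiation.\<close>

definition wave :: "real \<Rightarrow> real \<Rightarrow> nat \<Rightarrow> real \<Rightarrow> complex" where
  "wave \<xi> N j x = exp (\<i> * of_real \<xi> * of_real x) * inverse (of_real x + \<i> * of_real N) ^ j"

lemma wave_pole_nonzero: "0 < N \<Longrightarrow> complex_of_real x + \<i> * of_real N \<noteq> 0"
  by (auto simp: complex_eq_iff)

lemma norm_wave: "cmod (wave \<xi> N j x) = inverse (cmod (of_real x + \<i> * of_real N)) ^ j"
proof -
  have "cmod (exp (\<i> * of_real \<xi> * of_real x)) = 1" by simp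
  then show ?thesis unfolding wave_def norm_mult norm_power norm_inverse by simp
qed

lemma norm_pole_ge: "0 < N \<Longrightarrow> N \<le> cmod (of_real x + \<i> * of_real N)"
  using abs_Im_le_cmod[of "of_real x + \<i> * of_real N"] by simp

text \<open>The inverse of the pole distance is at most 1/N \<le> 1; of the extra powers beyond the
  first, one is traded for 1/N and the others are dropped.\<close>

lemma norm_wave_le:
  assumes "1 \<le> N" "2 \<le> j"
  shows "cmod (wave \<xi> N j x) \<le> cmod (wave \<xi> N 1 x) / N"
proof -
  let ?v = "inverse (cmod (of_real x + \<i> * of_real N))"
  have v: "0 \<le> ?v" "?v \<le> 1 / N"
    using norm_pole_ge[of N x] assms by (auto simp: inverse_eq_divide intro!: frac_le)
  then have v1: "?v \<le> 1" using assms by (smt (verit) divide_le_eq_1)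
  have "?v ^ j \<le> ?v ^ 2" using v v1 assms by (intro power_decreasing) auto
  also have "\<dots> \<le> ?v * (1 / N)" unfolding power2_eq_square by (intro mult_left_mono v)
  finally show ?thesis unfolding norm_wave by simp
qed

lemma wave_continuous: "0 < N \<Longrightarrow> continuous_on UNIV (wave \<xi> N j)"
  unfolding wave_def[abs_def] by (intro continuous_intros) (simp add: wave_pole_nonzero)

lemma wave_sq_int:
  assumes "1 \<le> N" "1 \<le> j" shows "sq_int (wave \<xi> N j)"
proof (rule sq_int_dominated)
  show "integrable lborel (\<lambda>x::real. inverse (1 + x\<^sup>2))"
    using integrable_inverse_1_plus_square by (simp add: set_integrable_def)
  show "wave \<xi> N j \<in> borel_measurable borel"
    using assms by (intro borel_measurable_continuous_onI wave_continuous) simp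
  fix x
  have "cmod (wave \<xi> N j x) \<le> cmod (wave \<xi> N 1 x)"
  proof (cases "j = 1")
    case False
    then have "cmod (wave \<xi> N j x) \<le> cmod (wave \<xi> N 1 x) / N"
      using assms by (intro norm_wave_le) auto
    also have "\<dots> \<le> cmod (wave \<xi> N 1 x)"
      using assms by (simp add: divide_le_eq mult_le_cancel_left1)
    finally show ?thesis .
  qed simp
  then have "(cmod (wave \<xi> N j x))\<^sup>2 \<le> (cmod (wave \<xi> N 1 x))\<^sup>2" by (intro power_mono) auto
  also have "\<dots> = inverse (x\<^sup>2 + N\<^sup>2)"
    unfolding norm_wave by (simp add: power_inverse cmod_power2)
  also have "\<dots> \<le> inverse (1 + x\<^sup>2)"
    using assms by (intro le_imp_inverse_le) (auto simp: add_pos_nonneg)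
  finally show "(cmod (wave \<xi> N j x))\<^sup>2 \<le> inverse (1 + x\<^sup>2)" .
qed

lemma L2norm_wave_pos:
  assumes "1 \<le> N" shows "0 < L2norm (wave \<xi> N 1)"
proof -
  have "(LINT x|lborel. indicator {0..1::real} x * inverse (1 + N\<^sup>2)) \<le> (LINT x|lborel. (cmod (wave \<xi> N 1 x))\<^sup>2)"
  proof (rule integral_mono)
    fix x :: real
    have "(cmod (wave \<xi> N 1 x))\<^sup>2 = inverse (x\<^sup>2 + N\<^sup>2)"
      unfolding norm_wave by (simp add: power_inverse cmod_power2)
    moreover have "inverse (1 + N\<^sup>2) \<le> inverse (x\<^sup>2 + N\<^sup>2)" if "x \<in> {0..1}"
      using that assms by (intro le_imp_inverse_le) (auto simp: power_le_one add_nonneg_pos)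
    ultimately show "indicator {0..1} x * inverse (1 + N\<^sup>2) \<le> (cmod (wave \<xi> N 1 x))\<^sup>2"
      by (auto simp: indicator_def)
  qed (use assms wave_sq_int[of N 1 \<xi>] in \<open>auto simp: sq_int_def intro!: integrable_real_indicator\<close>)
  moreover have "0 < (LINT x|lborel. indicator {0..1::real} x * inverse (1 + N\<^sup>2))"
    by (simp add: add_pos_nonneg)
  ultimately have "0 < (LINT x|lborel. (cmod (wave \<xi> N 1 x))\<^sup>2)" by linarith
  then show ?thesis unfolding L2norm_def by (rule real_sqrt_gt_zero)
qed

text \<open>The wave is the restriction to the real line of a function holomorphic away from -iN, so
  its derivative is the complex one.\<close>

lemma wave_H1_rep:
  assumes "1 \<le> N" "1 \<le> j"
  shows "H1_rep (wave \<xi> N j) (\<lambda>x. \<i> * of_real \<xi> * wave \<xi> N j x + (- of_nat j) * wave \<xi> N (Suc j) x)"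
proof (rule H1_repI_deriv)
  show "sq_int (wave \<xi> N j)" using assms by (rule wave_sq_int)
  show "sq_int (\<lambda>x. \<i> * of_real \<xi> * wave \<xi> N j x + (- of_nat j) * wave \<xi> N (Suc j) x)"
    using assms by (intro sq_int_add sq_int_scale wave_sq_int) auto
  show "continuous_on UNIV (\<lambda>x. \<i> * of_real \<xi> * wave \<xi> N j x + (- of_nat j) * wave \<xi> N (Suc j) x)"
    using assms by (intro continuous_intros wave_continuous) auto
  show "(wave \<xi> N j has_vector_derivative \<i> * of_real \<xi> * wave \<xi> N j x + (- of_nat j) * wave \<xi> N (Suc j) x) (at x)" for x
  proof -
    obtain i where j: "j = Suc i" using assms(2) by (cases j) auto
    let ?r = "\<lambda>z. inverse (z + \<i> * of_real N)"
    have nz: "complex_of_real x + \<i> * of_real N \<noteq> 0" using wave_pole_nonzero assms(1) by simp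
    have "(?r has_field_derivative - (?r (of_real x))\<^sup>2) (at (of_real x))"
      using nz by (auto intro!: derivative_eq_intros simp: power2_eq_square)
    from DERIV_power_Suc[OF this, of i]
    have r: "((\<lambda>z. ?r z ^ j) has_field_derivative - of_nat j * ?r (of_real x) ^ Suc j) (at (of_real x))"
      by (simp add: j algebra_simps power2_eq_square)
    have ex: "((\<lambda>z. exp (\<i> * of_real \<xi> * z)) has_field_derivative
        \<i> * of_real \<xi> * exp (\<i> * of_real \<xi> * of_real x)) (at (of_real x))"
      by (auto intro!: derivative_eq_intros)
    have "((\<lambda>z. exp (\<i> * of_real \<xi> * z) * ?r z ^ j) has_field_derivative
       \<i> * of_real \<xi> * wave \<xi> N j x + (- of_nat j) * wave \<xi> N (Suc j) x) (at (of_real x))"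
      using DERIV_mult[OF ex r] by (simp add: wave_def mult_ac)
    from has_vector_derivative_real_field[OF this] show ?thesis by (simp add: wave_def[abs_def])
  qed
qed

lemma wave_H2_rep:
  assumes "1 \<le> N" "1 \<le> j"
  shows "H2_rep (wave \<xi> N j) (\<lambda>x. - (of_real \<xi>)\<^sup>2 * wave \<xi> N j x
    - 2 * of_nat j * \<i> * of_real \<xi> * wave \<xi> N (j + 1) x + of_nat (j * (j + 1)) * wave \<xi> N (j + 2) x)"
proof -
  let ?f1 = "\<lambda>x. \<i> * of_real \<xi> * wave \<xi> N j x + (- of_nat j) * wave \<xi> N (Suc j) x"
  let ?f2 = "\<lambda>x. \<i> * of_real \<xi> * (\<i> * of_real \<xi> * wave \<xi> N j x + (- of_nat j) * wave \<xi> N (Suc j) x)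
    + (- of_nat j) * (\<i> * of_real \<xi> * wave \<xi> N (Suc j) x + (- of_nat (Suc j)) * wave \<xi> N (Suc (Suc j)) x)"
  have "H1_rep ?f1 ?f2"
    using assms by (intro H1_rep_add H1_rep_scale wave_H1_rep) auto
  moreover have "?f2 = (\<lambda>x. - (of_real \<xi>)\<^sup>2 * wave \<xi> N j x
    - 2 * of_nat j * \<i> * of_real \<xi> * wave \<xi> N (j + 1) x + of_nat (j * (j + 1)) * wave \<xi> N (j + 2) x)"
    by (rule ext) (simp add: algebra_simps power2_eq_square)
  ultimately show ?thesis
    unfolding H2_rep_iff_H1_rep using wave_H1_rep[OF assms, of \<xi>] by (intro exI[of _ ?f1]) simp
qed

text \<open>Waves \<open>exp (\<i> \<xi> x) / (x + \<i> N)\<close> are approximate eigenfunctions as \<open>N \<rightarrow> \<infinity>\<close>: differentiating the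
  amplitude gains a factor \<open>1 / N\<close> pointwise. Starting from \<open>h\<close> and setting \<open>f = h - h'' / \<alpha>\<^sup>2\<close>
  makes \<open>\<phi> * f = h\<close> explicit.\<close>
lemma symbol_value_in_spectrum:
  assumes d: "0 < d" and \<alpha>: "0 < \<alpha>" and s: "0 \<le> s"
  shows "complex_of_real (symbol_numerator d c b \<alpha> s / (\<alpha>\<^sup>2 + s)) \<in> spectrum_L d c b (kernel \<alpha>)"
proof (rule ccontr)
  define \<mu> where "\<mu> = symbol_numerator d c b \<alpha> s / (\<alpha>\<^sup>2 + s)"
  define \<xi> where "\<xi> = sqrt s"
  define X B M where "X = complex_of_real \<xi>" and "B = (complex_of_real \<alpha>)\<^sup>2" and "M = complex_of_real (b + \<mu>)"
  assume "complex_of_real (symbol_numerator d c b \<alpha> s / (\<alpha>\<^sup>2 + s)) \<notin> spectrum_L d c b (kernel \<alpha>)"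
  \<comment> \<open>The resolvent set supplies a lower bound for L - \<mu>, which the waves will
    violate. The sign of \<open>K0\<close> is unknown, hence the absolute values below.\<close>
  then obtain K0 where K0: "\<And>f f2. H2_rep f f2 \<Longrightarrow>
      L2norm f \<le> K0 * L2norm (\<lambda>x. Lop d c b (kernel \<alpha>) f f2 x - complex_of_real \<mu> * f x)"
    unfolding spectrum_L_def resolvent_set_def \<mu>_def by blast
  have B: "B \<noteq> 0" using \<alpha> by (simp add: B_def)
  \<comment> \<open>Coefficients of f = h - h'' / B in the waves of index 1, 2, 3, where h is the
    wave of index 1.\<close>
  define A1 A2 A3 where "A1 = 1 + X\<^sup>2 / B" and "A2 = 2 * \<i> * X / B" and "A3 = - 2 / B"
  have pos: "0 < \<alpha>\<^sup>2 + s" using \<alpha> s by (simp add: add_pos_nonneg)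
  have \<xi>2: "\<xi>\<^sup>2 = s" using s by (simp add: \<xi>_def)
  \<comment> \<open>The coefficient of the leading wave in (L - \<mu>) f; it vanishes because \<mu>
    is the symbol value at frequency \<xi>.\<close>
  have zero: "of_real d * X\<^sup>2 * A1 + of_real (c\<^sup>2) - M * A1 = 0"
  proof -
    have "\<mu> * (\<alpha>\<^sup>2 + s) = symbol_numerator d c b \<alpha> s" using pos by (simp add: \<mu>_def)
    then have "d * s * (1 + s / \<alpha>\<^sup>2) + c\<^sup>2 - (b + \<mu>) * (1 + s / \<alpha>\<^sup>2) = 0"
      using \<alpha> by (simp add: symbol_numerator_def field_simps power2_eq_square)
    moreover have "of_real d * X\<^sup>2 * A1 + of_real (c\<^sup>2) - M * A1 =
        complex_of_real (d * s * (1 + s / \<alpha>\<^sup>2) + c\<^sup>2 - (b + \<mu>) * (1 + s / \<alpha>\<^sup>2))"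
      by (simp add: A1_def X_def B_def M_def flip: \<xi>2)
    ultimately show ?thesis by simp
  qed
  have A1: "1 \<le> cmod A1"
  proof -
    have "A1 = complex_of_real (1 + s / \<alpha>\<^sup>2)" by (simp add: A1_def X_def B_def flip: \<xi>2)
    then show ?thesis using s by (simp only: norm_of_real) simp
  qed
  \<comment> \<open>The remaining coefficients of (L - \<mu>) f, at the waves of index 2 to 5. They
    do not depend on N, and each of these waves is smaller than the leading one by a factor
    1/N.\<close>
  define E2 E3 E4 E5 where
    "E2 = of_real d * (2 * \<i> * X * A1 + X\<^sup>2 * A2) - M * A2" and
    "E3 = of_real d * (- 2 * A1 + 4 * \<i> * X * A2 + X\<^sup>2 * A3) - M * A3" and
    "E4 = of_real d * (- 6 * A2 + 6 * \<i> * X * A3)" and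
    "E5 = of_real d * (- 12 * A3)"
  define K where "K = cmod E2 + cmod E3 + cmod E4 + cmod E5"
  \<comment> \<open>The second summand lets the leading wave dominate f up to a factor 1/2; the
    third makes |K0| K / N smaller than 1/2, which contradicts the bound.\<close>
  define N where "N = 1 + 2 * (cmod A2 + cmod A3) + 2 * \<bar>K0\<bar> * K"
  have Knn: "0 \<le> K" by (simp add: K_def)
  have N: "1 \<le> N" "2 * (cmod A2 + cmod A3) \<le> N" "2 * \<bar>K0\<bar> * K < N"
    using Knn by (auto simp: N_def add_nonneg_nonneg mult_nonneg_nonneg add_pos_nonneg)
  let ?e = "wave \<xi> N"
  define f where "f = (\<lambda>x. (A1 * ?e 1 x + A2 * ?e 2 x) + A3 * ?e 3 x)"
  define f2 where "f2 = (\<lambda>x. (A1 * (- X\<^sup>2 * ?e 1 x - 2 * \<i> * X * ?e 2 x + 2 * ?e 3 x)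
      + A2 * (- X\<^sup>2 * ?e 2 x - 4 * \<i> * X * ?e 3 x + 6 * ?e 4 x))
      + A3 * (- X\<^sup>2 * ?e 3 x - 6 * \<i> * X * ?e 4 x + 12 * ?e 5 x))"
  have e: "H2_rep (?e 1) (\<lambda>x. - X\<^sup>2 * ?e 1 x - 2 * \<i> * X * ?e 2 x + 2 * ?e 3 x)"
      "H2_rep (?e 2) (\<lambda>x. - X\<^sup>2 * ?e 2 x - 4 * \<i> * X * ?e 3 x + 6 * ?e 4 x)"
      "H2_rep (?e 3) (\<lambda>x. - X\<^sup>2 * ?e 3 x - 6 * \<i> * X * ?e 4 x + 12 * ?e 5 x)"
    using wave_H2_rep[OF N(1), of 1 \<xi>] wave_H2_rep[OF N(1), of 2 \<xi>] wave_H2_rep[OF N(1), of 3 \<xi>]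
    by (simp_all add: X_def del: One_nat_def)
  have f: "H2_rep f f2"
    unfolding f_def f2_def by (intro H2_rep_add H2_rep_scale e)
  have "- X\<^sup>2 * ?e 1 x - 2 * \<i> * X * ?e 2 x + 2 * ?e 3 x = B * (?e 1 x - f x)" for x
    using B by (simp add: f_def A1_def A2_def A3_def field_simps)
  with e(1) have "H2_rep (?e 1) (\<lambda>x. B * (?e 1 x - f x))" by (simp only:)
  then have conv: "conv (kernel \<alpha>) f = ?e 1"
    unfolding B_def by (rule conv_kernel_unique[OF \<alpha> _ H2_rep_sq_int(1)[OF f]])
  define g where "g = (\<lambda>x. E2 * ?e 2 x + E3 * ?e 3 x + E4 * ?e 4 x + E5 * ?e 5 x)"
  have "Lop d c b (kernel \<alpha>) f f2 x - complex_of_real \<mu> * f x = g x" for x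
  proof -
    have "Lop d c b (kernel \<alpha>) f f2 x - complex_of_real \<mu> * f x
        = - of_real d * f2 x + of_real (c\<^sup>2) * ?e 1 x - M * f x"
      by (simp add: Lop_def conv M_def algebra_simps)
    also have "\<dots> = (of_real d * X\<^sup>2 * A1 + of_real (c\<^sup>2) - M * A1) * ?e 1 x + g x"
      by (simp add: f_def f2_def g_def E2_def E3_def E4_def E5_def algebra_simps)
    finally show ?thesis using zero by simp
  qed
  then have bound: "L2norm f \<le> K0 * L2norm g" using K0[OF f] by simp
  have sq: "sq_int (?e j)" if "1 \<le> j" for j using wave_sq_int[OF N(1) that] .
  have sq_g: "sq_int g" unfolding g_def by (intro sq_int_add sq_int_scale sq) auto
  have small: "cmod (a * ?e j x) \<le> cmod a * (cmod (?e 1 x) / N)" if "2 \<le> j" for a j x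
    unfolding norm_mult by (intro mult_left_mono norm_wave_le N that) auto
  have "cmod (1/2 * ?e 1 x) \<le> cmod (f x)" for x
  proof -
    have "cmod (A2 * ?e 2 x + A3 * ?e 3 x) \<le> (cmod A2 + cmod A3) * (cmod (?e 1 x) / N)"
      using norm_triangle_ineq[of "A2 * ?e 2 x" "A3 * ?e 3 x"] small[of 2 A2 x] small[of 3 A3 x]
      unfolding distrib_right by linarith
    also have "\<dots> = (cmod A2 + cmod A3) / N * cmod (?e 1 x)" by simp
    also have "\<dots> \<le> 1/2 * cmod (?e 1 x)"
      using N by (intro mult_right_mono) (auto simp: field_simps)
    finally have "cmod (A2 * ?e 2 x + A3 * ?e 3 x) \<le> 1/2 * cmod (?e 1 x)" .
    moreover have "cmod (?e 1 x) \<le> cmod (A1 * ?e 1 x)"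
      unfolding norm_mult using A1 by (simp add: mult_le_cancel_right1)
    moreover have "cmod (A1 * ?e 1 x) - cmod (A2 * ?e 2 x + A3 * ?e 3 x) \<le> cmod (f x)"
      using norm_diff_ineq[of "A1 * ?e 1 x" "A2 * ?e 2 x + A3 * ?e 3 x"] by (simp add: f_def add.assoc)
    ultimately show ?thesis by (simp add: norm_mult)
  qed
  then have "L2norm (\<lambda>x. 1/2 * ?e 1 x) \<le> L2norm f"
    using sq H2_rep_sq_int(1)[OF f] by (intro L2norm_mono sq_int_scale) auto
  then have lower: "1/2 * L2norm (?e 1) \<le> L2norm f" unfolding L2norm_scale by simp
  have "cmod (g x) \<le> cmod (of_real (K / N) * ?e 1 x)" for x
  proof -
    have "cmod (g x) \<le> cmod (E2 * ?e 2 x) + cmod (E3 * ?e 3 x) + cmod (E4 * ?e 4 x) + cmod (E5 * ?e 5 x)"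
      unfolding g_def by (intro norm_triangle_le add_mono) auto
    also have "\<dots> \<le> K * (cmod (?e 1 x) / N)"
      unfolding K_def distrib_right by (intro add_mono small) auto
    also have "\<dots> = cmod (of_real (K / N) * ?e 1 x)"
      unfolding norm_mult norm_of_real using N Knn by simp
    finally show ?thesis .
  qed
  then have "L2norm g \<le> L2norm (\<lambda>x. of_real (K / N) * ?e 1 x)"
    using sq sq_g by (intro L2norm_mono sq_int_scale) auto
  then have upper: "L2norm g \<le> K / N * L2norm (?e 1)"
    unfolding L2norm_scale norm_of_real using N Knn by simp
  have "1/2 * L2norm (?e 1) \<le> \<bar>K0\<bar> * L2norm g"
    using lower bound mult_right_mono[OF abs_ge_self[of K0] L2norm_nonneg[of g]] by linarith
  also have "\<dots> \<le> \<bar>K0\<bar> * (K / N * L2norm (?e 1))"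
    by (intro mult_left_mono upper) simp
  finally have "1/2 * L2norm (?e 1) \<le> (\<bar>K0\<bar> * K / N) * L2norm (?e 1)" by simp
  then have "1/2 \<le> \<bar>K0\<bar> * K / N"
    using L2norm_wave_pos[OF N(1)] by (simp only: mult_le_cancel_right_pos)
  then show False using N by (simp add: field_simps)
qed

subsection \<open>Stability thresholds\<close>

lemma spectrally_unstableI:
  assumes "0 < d" "0 < \<alpha>" "0 \<le> s" "symbol_numerator d c b \<alpha> s < 0"
  shows "spectrally_unstable d c b (kernel \<alpha>)"
proof -
  have "symbol_numerator d c b \<alpha> s / (\<alpha>\<^sup>2 + s) < 0"
    using assms by (intro divide_neg_pos) (auto simp: add_pos_nonneg)
  then show ?thesis
    unfolding spectrally_unstable_def using symbol_value_in_spectrum[OF assms(1-3)] by blast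
qed

lemma spectral_stability_threshold:
  assumes "0 < b" "0 < d" "0 < \<alpha>" "0 < c" "b \<le> c\<^sup>2"
  shows "(c - sqrt (c\<^sup>2 - b))\<^sup>2 / \<alpha>\<^sup>2 \<le> d \<Longrightarrow> spectrally_stable d c b (kernel \<alpha>)"
    and "d < (c - sqrt (c\<^sup>2 - b))\<^sup>2 / \<alpha>\<^sup>2 \<Longrightarrow> spectrally_unstable d c b (kernel \<alpha>)"
proof -
  \<comment> \<open>In these variables the threshold reads c - e \<le> t, that is, c \<le> t +
    e.\<close>
  define e t where "e = sqrt (c\<^sup>2 - b)" and "t = sqrt d * \<alpha>"
  have e: "0 \<le> e" "e\<^sup>2 = c\<^sup>2 - b" using assms by (auto simp: e_def)
  have t: "0 < t" "t\<^sup>2 = d * \<alpha>\<^sup>2" using assms by (auto simp: t_def power_mult_distrib)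
  have "e < c" using e assms by (intro power_less_imp_less_base[of e 2 c]) auto
  \<comment> \<open>Once c \<le> t + e, both summands are nonnegative for s \<ge> 0, which is
    stability.\<close>
  have q: "symbol_numerator d c b \<alpha> s = (sqrt d * s - e * \<alpha>)\<^sup>2 + ((t + e)\<^sup>2 - c\<^sup>2) * s" for s
  proof -
    have "(sqrt d * s - e * \<alpha>)\<^sup>2 + ((t + e)\<^sup>2 - c\<^sup>2) * s
        = (sqrt d)\<^sup>2 * s\<^sup>2 + (t\<^sup>2 + e\<^sup>2 - c\<^sup>2) * s + e\<^sup>2 * \<alpha>\<^sup>2"
      unfolding t_def by (simp add: power2_eq_square algebra_simps)
    then show ?thesis
      using assms by (simp add: e t symbol_numerator_def)
  qed
  {
    assume "(c - sqrt (c\<^sup>2 - b))\<^sup>2 / \<alpha>\<^sup>2 \<le> d"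
    then have "(c - e)\<^sup>2 \<le> t\<^sup>2" using assms by (simp add: t e_def divide_le_eq)
    then have "c - e \<le> t" using t by (metis power2_le_imp_le less_imp_le)
    then have "c\<^sup>2 \<le> (t + e)\<^sup>2" using assms by (intro power_mono) auto
    then show "spectrally_stable d c b (kernel \<alpha>)"
      using assms by (intro spectrally_stableI) (auto simp: q)
  }
  {
    assume "d < (c - sqrt (c\<^sup>2 - b))\<^sup>2 / \<alpha>\<^sup>2"
    then have "t\<^sup>2 < (c - e)\<^sup>2" using assms by (simp add: t e_def less_divide_eq)
    then have "t < c - e" using \<open>e < c\<close> by (intro power2_less_imp_less[of t "c - e"]) auto
    then have "(t + e)\<^sup>2 < c\<^sup>2" using e t by (intro power_strict_mono) auto
    then have te: "2 * t * e < b - t\<^sup>2" using e by (simp add: power2_sum)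
    then have bt: "0 < b - t\<^sup>2" using e t by (smt (verit) mult_nonneg_nonneg)
    \<comment> \<open>The vertex of the quadratic. The zero of the completed square above would not
      do in general: when e = 0 it is s = 0, where the symbol numerator vanishes.\<close>
    define s where "s = (b - t\<^sup>2) / (2 * d)"
    have "4 * d * symbol_numerator d c b \<alpha> s = (2 * t * e)\<^sup>2 - (b - t\<^sup>2)\<^sup>2"
    proof -
      have "b - t\<^sup>2 = 2 * d * s" using assms by (simp add: s_def)
      then have *: "d * \<alpha>\<^sup>2 - b = - (2 * d * s)" by (simp add: t)
      have "4 * d * symbol_numerator d c b \<alpha> s = 4 * (d * \<alpha>\<^sup>2) * e\<^sup>2 - (2 * d * s)\<^sup>2"
        unfolding symbol_numerator_def * e(2)[symmetric] by (simp add: power2_eq_square algebra_simps)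
      then show ?thesis using \<open>b - t\<^sup>2 = 2 * d * s\<close> by (simp add: t(2)[symmetric] power_mult_distrib)
    qed
    moreover have "(2 * t * e)\<^sup>2 < (b - t\<^sup>2)\<^sup>2"
      using te e t by (intro power_strict_mono) auto
    ultimately have "4 * d * symbol_numerator d c b \<alpha> s < 0" by simp
    then have "symbol_numerator d c b \<alpha> s < 0" using assms by (simp add: mult_less_0_iff)
    moreover have "0 \<le> s" using bt assms by (simp add: s_def)
    ultimately show "spectrally_unstable d c b (kernel \<alpha>)"
      using assms by (intro spectrally_unstableI)
  }
qed

theorem theorem2:
  fixes a b d \<alpha> :: real
  assumes "a > 0" and "b > 0" and "d > 0" and "\<alpha> > 0" and "a^2 / 4 \<ge> b"
  shows "(a^2 / 4 > b \<longrightarrow>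
            (d \<ge> (c1 a b - sqrt ((c1 a b)^2 - b))^2 / \<alpha>^2 \<longrightarrow>
               spectrally_stable d (c1 a b) b (kernel \<alpha>)) \<and>
            (d < (c1 a b - sqrt ((c1 a b)^2 - b))^2 / \<alpha>^2 \<longrightarrow>
               spectrally_unstable d (c1 a b) b (kernel \<alpha>)) \<and>
            spectrally_unstable d (c2 a b) b (kernel \<alpha>)) \<and>
         (a^2 / 4 = b \<longrightarrow>
            (\<forall>c \<in> {c1 a b, c2 a b}.
               (d \<ge> b / \<alpha>^2 \<longrightarrow> spectrally_stable d c b (kernel \<alpha>)) \<and>
               (d < b / \<alpha>^2 \<longrightarrow> spectrally_unstable d c b (kernel \<alpha>))))"
proof -
  define e where "e = sqrt (a\<^sup>2 / 4 - b)"
  have e: "0 \<le> e" "e\<^sup>2 = (a / 2)\<^sup>2 - b" using assms by (auto simp: e_def power_divide)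
  have c12: "c1 a b = a / 2 + e" "c2 a b = a / 2 - e" by (simp_all add: c1_def c2_def e_def)
  have c1: "0 < c1 a b" "b \<le> (c1 a b)\<^sup>2"
  proof -
    show "0 < c1 a b" using assms e by (simp add: c12 add_pos_nonneg)
    have "(a / 2)\<^sup>2 \<le> (c1 a b)\<^sup>2" unfolding c12 using assms e by (intro power_mono) auto
    then show "b \<le> (c1 a b)\<^sup>2" using assms by (simp add: power_divide)
  qed
  have "spectrally_unstable d (c2 a b) b (kernel \<alpha>)" if "a\<^sup>2 / 4 > b"
  \<comment> \<open>Zero frequency suffices: the numerator there is (c2^2 - b) \<alpha>^2, and c2^2
    < c1 c2 = b since 0 < c2 < c1.\<close>
  proof (rule spectrally_unstableI[where s = 0])
    have "0 < e" using that by (simp add: e_def)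
    have "e < a / 2" using e assms by (intro power_less_imp_less_base[of e 2 "a / 2"]) auto
    then have "(c2 a b)\<^sup>2 < c2 a b * c1 a b"
      using \<open>0 < e\<close> by (simp add: c12 power2_eq_square)
    also have "\<dots> = b" using e(2) by (simp add: c12 power2_eq_square algebra_simps)
    finally show "symbol_numerator d (c2 a b) b \<alpha> 0 < 0"
      using assms by (simp add: symbol_numerator_def mult_less_0_iff)
  qed (use assms in auto)
  moreover have "(d \<ge> b / \<alpha>\<^sup>2 \<longrightarrow> spectrally_stable d c b (kernel \<alpha>)) \<and>
      (d < b / \<alpha>\<^sup>2 \<longrightarrow> spectrally_unstable d c b (kernel \<alpha>))"
    if "a\<^sup>2 / 4 = b" "c \<in> {c1 a b, c2 a b}" for c
  proof -
    \<comment> \<open>In the degenerate case both constants coincide and c^2 = b, so the inner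
      square root of the threshold is 0 and the threshold reduces to b / \<alpha>^2.\<close>
    have "c = a / 2" using that by (auto simp: c12 e_def)
    then have "0 < c" "c\<^sup>2 = b" using that assms by (auto simp: power_divide)
    then show ?thesis
      using spectral_stability_threshold[of b d \<alpha> c] assms by simp
  qed
  ultimately show ?thesis
    using spectral_stability_threshold[of b d \<alpha> "c1 a b"] c1 assms by blast
qed

end
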